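(* Let $\Omega_1$ and $\Omega_2$ be topological spaces equipped with their Borel $\sigma$-algebras and let $\kappa:\Omega_1\to\Omega_2$ be a statistic (i.e. a measurable map). Assume that $(M,\Omega_1,\mu_1,p_1)$ and $(M,\Omega_2,\kappa_*(\mu_1),\kappa_*(p_1))$ are $2$-integrable parametrized measure models, where $\kappa_*(p_1)(x):=\kappa_*(p_1(x))$. Then for all $x\in M$ and all $V\in T_xM$, $$g^F_{(M,\Omega_1,\mu_1,p_1)}(V,V)\;\ge\; g^F_{(M,\Omega_2,\kappa_*(\mu_1),\kappa_*(p_1))}(V,V),$$ where $g^F$ denotes the Fisher quadratic form of the respective model.
   Context: For a measurable space $\Omega$, $\mathcal M(\Omega)$ is the set of all finite non-negative measures on $\Omega$. For $\mu_0\in\mathcal M(\Omega)$ put $\mathcal M_+(\Omega,\mu_0)=\{\phi\mu_0 : \phi\in L^1(\Omega,\mu_0),\ \phi>0\ \mu_0\text{-a.e.}\}$. $\kappa_*$ denotes push-forward of measures. Let $k\ge 1$. A $k$-integrable parametrized measure model is a quadruple $(M,\Omega,\mu,p)$ consisting of a smooth (finite or infinite dimensional) Banach manifold $M$, a measure $\mu\in\mathcal M(\Omega)$, and a continuous map $p:M\to\mathcal M_+(\Omega,\mu)$, where $\mathcal M_+(\Omega,\mu)$ has the $L^1$-topology, such that there is a density potential $\bar p=\frac{dp}{d\mu}:M\times\Omega\to\mathbb R$ with $p(x)=\bar p(x,\omega)\,d\mu(\omega)$ satisfying: (1) for $\mu$-almost all $\omega\in\Omega$ the function $x\mapsto\ln\bar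 p(x,\omega)$ is defined on $M$ and continuously Gateaux-differentiable (i.e. its Gateaux differential is continuous as a function on $TM$); (2) for every continuous vector field $V$ on $M$ the function $\omega\mapsto\partial_V\ln\bar p(x,\omega)$ belongs to $L^k(\Omega,p(x))$, and the function $x\mapsto\|\partial_V\ln\bar p(x,\omega)\|_{L^k(\Omega,p(x))}$ is continuous on $M$. The Fisher quadratic form of a $2$-integrable parametrized measure model $(M,\Omega,\mu,p)$ is $$g^F_{(M,\Omega,\mu,p)}(V,W)_x=\int_\Omega \partial_V\ln\bar p(x,\omega)\,\partial_W\ln\bar p(x,\omega)\,dp(x),\qquad V,W\in T_xM.$$ *)

theory Defs
  imports "HOL-Analysis.Analysis"
begin

section \<open>Smooth maps between Banach spaces\<close>

definition bounded_multilinear ::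
    "nat \<Rightarrow> ('a::real_normed_vector list \<Rightarrow> 'b::real_normed_vector) \<Rightarrow> bool" where
  "bounded_multilinear n T \<longleftrightarrow>
     (\<forall>vs i. length vs = n \<and> i < n \<longrightarrow> linear (\<lambda>v. T (vs[i := v]))) \<and>
     (\<exists>C. \<forall>vs. length vs = n \<longrightarrow> norm (T vs) \<le> C * prod_list (map norm vs))"

text \<open>
  \<open>f\<close> is \<open>C\<^sup>\<infinity>\<close> on the open set \<open>S\<close> in the sense of Frechet.  The \<open>n\<close>-th derivative \<open>D n x\<close> is
  represented as a bounded \<open>n\<close>-linear map on argument lists of length \<open>n\<close> (so that all orders live
  in one type), and the last clause says that \<open>D n\<close>, as a map into the bounded \<open>n\<close>-linear maps with
  the operator norm, has the Frechet derivative \<open>D (Suc n) x\<close> at \<open>x\<close>.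
\<close>
definition frechet_smooth_on ::
    "'a::real_normed_vector set \<Rightarrow> ('a \<Rightarrow> 'b::real_normed_vector) \<Rightarrow> bool" where
  "frechet_smooth_on S f \<longleftrightarrow>
     (\<exists>D :: nat \<Rightarrow> 'a \<Rightarrow> 'a list \<Rightarrow> 'b.
        (\<forall>x\<in>S. D 0 x [] = f x) \<and>
        (\<forall>n. \<forall>x\<in>S. bounded_multilinear n (D n x)) \<and>
        (\<forall>n. \<forall>x\<in>S. \<forall>e>0. \<exists>d>0. \<forall>y\<in>S. dist y x < d \<longrightarrow>
           (\<forall>vs. length vs = n \<longrightarrow>
              norm (D n y vs - D n x vs - D (Suc n) x ((y - x) # vs))
                \<le> e * norm (y - x) * prod_list (map norm vs))))"

section \<open>Banach manifolds and their tangent vectors\<close>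

text \<open>
  The manifold \<open>M\<close> is the whole type \<open>'m\<close>, modelled on the Banach space \<open>'e\<close>.  A chart is a pair of
  its domain and a coordinate map, whose values outside the domain are irrelevant.  The class
  \<open>t3_space\<close> asks for a regular Hausdorff topology, which every paracompact Hausdorff manifold and
  every finite-dimensional Hausdorff manifold has; it ensures that every tangent vector extends to a
  continuous global vector field, so that condition (2) on a model applies to it.
\<close>
type_synonym ('m, 'e) chart = "'m set \<times> ('m \<Rightarrow> 'e)"

definition chart_inv :: "('m, 'e) chart \<Rightarrow> 'e \<Rightarrow> 'm" where
  "chart_inv c = inv_into (fst c) (snd c)"

definition banach_manifold :: "('m::t3_space, 'e::banach) chart set \<Rightarrow> bool" where
  "banach_manifold A \<longleftrightarrow>
     (\<Union>c\<in>A. fst c) = UNIV \<and>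
     (\<forall>c\<in>A. open (fst c) \<and> open (snd c ` fst c) \<and>
        homeomorphism (fst c) (snd c ` fst c) (snd c) (chart_inv c)) \<and>
     (\<forall>c\<in>A. \<forall>c'\<in>A. frechet_smooth_on (snd c ` (fst c \<inter> fst c')) (snd c' \<circ> chart_inv c))"

definition charts_at :: "('m, 'e) chart set \<Rightarrow> 'm \<Rightarrow> ('m, 'e) chart set" where
  "charts_at A x = {c \<in> A. x \<in> fst c}"

text \<open>
  A tangent vector at \<open>x\<close> is the family of its coordinates in all charts around \<open>x\<close>, related by the
  derivatives of the coordinate changes (and \<open>0\<close> at all other arguments).
  \<open>tangent_vector A c x w\<close> is the one with coordinates \<open>w\<close> in the chart \<open>c\<close>.
\<close>
type_synonym ('m, 'e) tangent = "('m, 'e) chart \<Rightarrow> 'e"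

definition tangent_vector ::
    "('m, 'e::real_normed_vector) chart set \<Rightarrow> ('m, 'e) chart \<Rightarrow> 'm \<Rightarrow> 'e \<Rightarrow> ('m, 'e) tangent" where
  "tangent_vector A c x w =
     (\<lambda>c'. if c' \<in> charts_at A x
           then frechet_derivative (snd c' \<circ> chart_inv c) (at (snd c x)) w else 0)"

definition tangent_space ::
    "('m, 'e::real_normed_vector) chart set \<Rightarrow> 'm \<Rightarrow> ('m, 'e) tangent set" where
  "tangent_space A x = {v. \<forall>c\<in>charts_at A x. v = tangent_vector A c x (v c)}"

text \<open>
  Continuity of vector fields and of functions on the tangent bundle refers to the bundle charts
  \<open>(x, v) \<mapsto> (x, v c)\<close> from the part of the bundle over \<open>fst c\<close> to \<open>fst c \<times> UNIV\<close>.
\<close>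
definition continuous_vector_field ::
    "('m::topological_space, 'e::real_normed_vector) chart set \<Rightarrow> ('m \<Rightarrow> ('m, 'e) tangent) \<Rightarrow> bool" where
  "continuous_vector_field A V \<longleftrightarrow>
     (\<forall>x. V x \<in> tangent_space A x) \<and> (\<forall>c\<in>A. continuous_on (fst c) (\<lambda>x. V x c))"

definition continuous_on_tangent_bundle ::
    "('m::topological_space, 'e::real_normed_vector) chart set
       \<Rightarrow> ('m \<Rightarrow> ('m, 'e) tangent \<Rightarrow> real) \<Rightarrow> bool" where
  "continuous_on_tangent_bundle A F \<longleftrightarrow>
     (\<forall>c\<in>A. continuous_on (fst c \<times> UNIV) (\<lambda>(x, w). F x (tangent_vector A c x w)))"

section \<open>Gateaux differentials\<close>

definition has_gateaux_derivative ::
    "('m, 'e::real_normed_vector) chart set \<Rightarrow> ('m \<Rightarrow> real) \<Rightarrow> 'm \<Rightarrow> ('m, 'e) tangent \<Rightarrow> real \<Rightarrow> bool" where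
  "has_gateaux_derivative A f x v d \<longleftrightarrow>
     (\<forall>c\<in>charts_at A x.
        ((\<lambda>t. f (chart_inv c (snd c x + t *\<^sub>R v c))) has_real_derivative d) (at 0))"

definition gateaux_derivative ::
    "('m, 'e::real_normed_vector) chart set \<Rightarrow> ('m \<Rightarrow> real) \<Rightarrow> 'm \<Rightarrow> ('m, 'e) tangent \<Rightarrow> real" where
  "gateaux_derivative A f x v = (THE d. has_gateaux_derivative A f x v d)"

text \<open>
  Linearity of the differential in the tangent vector is not demanded separately: it follows from
  the continuity on the tangent bundle.
\<close>
definition continuously_gateaux_differentiable ::
    "('m::topological_space, 'e::real_normed_vector) chart set \<Rightarrow> ('m \<Rightarrow> real) \<Rightarrow> bool" where
  "continuously_gateaux_differentiable A f \<longleftrightarrow>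
     (\<forall>x. \<forall>v\<in>tangent_space A x. \<exists>d. has_gateaux_derivative A f x v d) \<and>
     continuous_on_tangent_bundle A (gateaux_derivative A f)"

section \<open>Spaces of measures and of integrable functions\<close>

definition M_plus :: "'a measure \<Rightarrow> 'a measure set" where
  "M_plus \<mu> = {density \<mu> (\<lambda>\<omega>. ennreal (\<phi> \<omega>)) | \<phi> :: 'a \<Rightarrow> real.
                 integrable \<mu> \<phi> \<and> (AE \<omega> in \<mu>. 0 < \<phi> \<omega>)}"

definition L1_dist :: "'a measure \<Rightarrow> 'a measure \<Rightarrow> 'a measure \<Rightarrow> real" where
  "L1_dist \<mu> \<nu> \<nu>' = (\<integral>\<omega>. \<bar>enn2real (RN_deriv \<mu> \<nu> \<omega>) - enn2real (RN_deriv \<mu> \<nu>' \<omega>)\<bar> \<partial>\<mu>)"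

definition L1_topology :: "'a measure \<Rightarrow> 'a measure topology" where
  "L1_topology \<mu> = Metric_space.mtopology (M_plus \<mu>) (L1_dist \<mu>)"

text \<open>
  The functions below are only determined almost everywhere (the logarithmic derivative need not
  exist on a null set), hence measurability is taken with respect to the completion: a real function
  is measurable for the completion iff it agrees almost everywhere with a measurable one.
\<close>
definition in_Lk :: "real \<Rightarrow> 'a measure \<Rightarrow> ('a \<Rightarrow> real) \<Rightarrow> bool" where
  "in_Lk k \<nu> f \<longleftrightarrow>
     f \<in> borel_measurable (completion \<nu>) \<and> integrable (completion \<nu>) (\<lambda>\<omega>. \<bar>f \<omega>\<bar> powr k)"

definition norm_Lk :: "real \<Rightarrow> 'a measure \<Rightarrow> ('a \<Rightarrow> real) \<Rightarrow> real" where
  "norm_Lk k \<nu> f = (\<integral>\<omega>. \<bar>f \<omega>\<bar> powr k \<partial>completion \<nu>) powr (1 / k)"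

section \<open>Parametrized measure models\<close>

text \<open>\<open>\<partial>\<^sub>V ln q(x, \<omega>)\<close> for a tangent vector \<open>V\<close> at \<open>x\<close>\<close>
definition log_derivative ::
    "('m, 'e::real_normed_vector) chart set \<Rightarrow> ('m \<Rightarrow> 'a \<Rightarrow> real) \<Rightarrow> 'm \<Rightarrow> ('m, 'e) tangent \<Rightarrow> 'a \<Rightarrow> real" where
  "log_derivative A q x v \<omega> = gateaux_derivative A (\<lambda>y. ln (q y \<omega>)) x v"

definition density_potential ::
    "real \<Rightarrow> ('m::t3_space, 'e::banach) chart set \<Rightarrow> 'a measure \<Rightarrow> ('m \<Rightarrow> 'a measure)
       \<Rightarrow> ('m \<Rightarrow> 'a \<Rightarrow> real) \<Rightarrow> bool" where
  "density_potential k A \<mu> p q \<longleftrightarrow>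
     (\<forall>x. q x \<in> borel_measurable \<mu> \<and> p x = density \<mu> (\<lambda>\<omega>. ennreal (q x \<omega>))) \<and>
     (AE \<omega> in \<mu>. (\<forall>x. 0 < q x \<omega>) \<and> continuously_gateaux_differentiable A (\<lambda>x. ln (q x \<omega>))) \<and>
     (\<forall>V. continuous_vector_field A V \<longrightarrow>
        (\<forall>x. in_Lk k (p x) (log_derivative A q x (V x))) \<and>
        continuous_on UNIV (\<lambda>x. norm_Lk k (p x) (log_derivative A q x (V x))))"

definition integrable_model ::
    "real \<Rightarrow> ('m::t3_space, 'e::banach) chart set \<Rightarrow> 'a measure \<Rightarrow> ('m \<Rightarrow> 'a measure) \<Rightarrow> bool" where
  "integrable_model k A \<mu> p \<longleftrightarrow>
     1 \<le> k \<and> banach_manifold A \<and> finite_measure \<mu> \<and>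
     continuous_map euclidean (L1_topology \<mu>) p \<and>
     (\<exists>q. density_potential k A \<mu> p q)"

text \<open>
  The value does not depend on the choice of the density potential, see \<open>fisher_form_eq\<close>.
\<close>
definition fisher_form ::
    "('m::t3_space, 'e::banach) chart set \<Rightarrow> 'a measure \<Rightarrow> ('m \<Rightarrow> 'a measure)
       \<Rightarrow> 'm \<Rightarrow> ('m, 'e) tangent \<Rightarrow> ('m, 'e) tangent \<Rightarrow> real" where
  "fisher_form A \<mu> p x V W =
     (let q = (SOME q. density_potential 2 A \<mu> p q) in
        \<integral>\<omega>. log_derivative A q x V \<omega> * log_derivative A q x W \<omega> \<partial>completion (p x))"

section \<open>Well-definedness\<close>

lemma RN_deriv_M_plus:
  assumes "finite_measure \<mu>" "\<nu> \<in> M_plus \<mu>"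
  obtains \<phi> where "integrable \<mu> \<phi>" "\<nu> = density \<mu> (\<lambda>\<omega>. ennreal (\<phi> \<omega>))"
    "AE \<omega> in \<mu>. 0 < \<phi> \<omega>" "AE \<omega> in \<mu>. enn2real (RN_deriv \<mu> \<nu> \<omega>) = \<phi> \<omega>"
proof -
  interpret finite_measure \<mu> by fact
  obtain \<phi> where \<phi>: "integrable \<mu> \<phi>" "\<nu> = density \<mu> (\<lambda>\<omega>. ennreal (\<phi> \<omega>))" "AE \<omega> in \<mu>. 0 < \<phi> \<omega>"
    using assms(2) by (auto simp: M_plus_def)
  have "AE \<omega> in \<mu>. ennreal (\<phi> \<omega>) = RN_deriv \<mu> \<nu> \<omega>"
    using \<phi> by (intro RN_deriv_unique) auto
  then have "AE \<omega> in \<mu>. enn2real (RN_deriv \<mu> \<nu> \<omega>) = \<phi> \<omega>"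
    using \<phi>(3) by eventually_elim (metis enn2real_ennreal less_imp_le)
  with \<phi> show thesis using that by blast
qed

lemma Metric_space_M_plus:
  assumes fin: "finite_measure \<mu>"
  shows "Metric_space (M_plus \<mu>) (L1_dist \<mu>)"
proof
  let ?r = "\<lambda>\<nu> \<omega>. enn2real (RN_deriv \<mu> \<nu> \<omega>)"
  have int: "integrable \<mu> (?r \<nu>)" if \<nu>: "\<nu> \<in> M_plus \<mu>" for \<nu>
  proof -
    obtain \<phi> where \<phi>: "integrable \<mu> \<phi>" "AE \<omega> in \<mu>. ?r \<nu> \<omega> = \<phi> \<omega>"
      using RN_deriv_M_plus[OF fin \<nu>] by metis
    show ?thesis
      using \<phi> by (subst integrable_cong_AE[where g = \<phi>]) auto
  qed
  show "0 \<le> L1_dist \<mu> \<nu> \<nu>'" for \<nu> \<nu>'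
    by (simp add: L1_dist_def)
  show "L1_dist \<mu> \<nu> \<nu>' = L1_dist \<mu> \<nu>' \<nu>" for \<nu> \<nu>'
    by (simp add: L1_dist_def abs_minus_commute)
  show "L1_dist \<mu> \<nu> \<nu>' = 0 \<longleftrightarrow> \<nu> = \<nu>'" if \<nu>: "\<nu> \<in> M_plus \<mu>" and \<nu>': "\<nu>' \<in> M_plus \<mu>" for \<nu> \<nu>'
  proof
    assume 0: "L1_dist \<mu> \<nu> \<nu>' = 0"
    have ae: "AE \<omega> in \<mu>. \<bar>?r \<nu> \<omega> - ?r \<nu>' \<omega>\<bar> = 0"
      using 0 int[OF \<nu>] int[OF \<nu>'] unfolding L1_dist_def
      by (subst integral_nonneg_eq_0_iff_AE[symmetric]) auto
    obtain \<phi> where \<phi>: "integrable \<mu> \<phi>" "\<nu> = density \<mu> (\<lambda>\<omega>. ennreal (\<phi> \<omega>))"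
      "AE \<omega> in \<mu>. ?r \<nu> \<omega> = \<phi> \<omega>"
      using RN_deriv_M_plus[OF fin \<nu>] by metis
    obtain \<psi> where \<psi>: "integrable \<mu> \<psi>" "\<nu>' = density \<mu> (\<lambda>\<omega>. ennreal (\<psi> \<omega>))"
      "AE \<omega> in \<mu>. ?r \<nu>' \<omega> = \<psi> \<omega>"
      using RN_deriv_M_plus[OF fin \<nu>'] by metis
    have "AE \<omega> in \<mu>. ennreal (\<phi> \<omega>) = ennreal (\<psi> \<omega>)"
      using ae \<phi>(3) \<psi>(3) by eventually_elim auto
    then show "\<nu> = \<nu>'"
      unfolding \<phi>(2) \<psi>(2) using \<phi>(1) \<psi>(1) by (intro density_cong) auto
  qed (simp add: L1_dist_def)
  show "L1_dist \<mu> \<nu>1 \<nu>3 \<le> L1_dist \<mu> \<nu>1 \<nu>2 + L1_dist \<mu> \<nu>2 \<nu>3"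
    if "\<nu>1 \<in> M_plus \<mu>" "\<nu>2 \<in> M_plus \<mu>" "\<nu>3 \<in> M_plus \<mu>" for \<nu>1 \<nu>2 \<nu>3
  proof -
    note i = int[OF that(1)] int[OF that(2)] int[OF that(3)]
    have "L1_dist \<mu> \<nu>1 \<nu>3 \<le> (\<integral>\<omega>. \<bar>?r \<nu>1 \<omega> - ?r \<nu>2 \<omega>\<bar> + \<bar>?r \<nu>2 \<omega> - ?r \<nu>3 \<omega>\<bar> \<partial>\<mu>)"
      unfolding L1_dist_def using i by (intro integral_mono) auto
    also have "\<dots> = L1_dist \<mu> \<nu>1 \<nu>2 + L1_dist \<mu> \<nu>2 \<nu>3"
      unfolding L1_dist_def using i by (intro Bochner_Integration.integral_add) auto
    finally show ?thesis .
  qed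
qed

lemma has_gateaux_derivative_imp_eq:
  assumes "banach_manifold A" "has_gateaux_derivative A f x v d"
  shows "gateaux_derivative A f x v = d"
proof -
  obtain c where "c \<in> charts_at A x"
    using assms(1) unfolding banach_manifold_def charts_at_def by fastforce
  then have "d' = d" if "has_gateaux_derivative A f x v d'" for d'
    using that assms(2) unfolding has_gateaux_derivative_def by (blast intro: DERIV_unique)
  then show ?thesis
    unfolding gateaux_derivative_def using assms(2) by blast
qed

lemma density_potentialD:
  assumes "density_potential k A \<mu> p q"
  shows "q x \<in> borel_measurable \<mu>" "p x = density \<mu> (\<lambda>\<omega>. ennreal (q x \<omega>))"
    "AE \<omega> in \<mu>. 0 < q x \<omega>"
    "AE \<omega> in \<mu>. continuously_gateaux_differentiable A (\<lambda>x. ln (q x \<omega>))"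
  using assms unfolding density_potential_def by (auto elim: eventually_mono)

lemma density_potential_AE_eq:
  assumes "finite_measure \<mu>" "density_potential k A \<mu> p q" "density_potential k A \<mu> p q'"
  shows "AE \<omega> in \<mu>. q y \<omega> = q' y \<omega>"
proof -
  interpret finite_measure \<mu> by fact
  have "AE \<omega> in \<mu>. ennreal (q y \<omega>) = ennreal (q' y \<omega>)"
  proof (rule density_unique)
    show "density \<mu> (\<lambda>\<omega>. ennreal (q y \<omega>)) = density \<mu> (\<lambda>\<omega>. ennreal (q' y \<omega>))"
      using density_potentialD(2)[OF assms(2)] density_potentialD(2)[OF assms(3)] by metis
  qed (use density_potentialD(1)[OF assms(2)] density_potentialD(1)[OF assms(3)] in measurable)
  moreover note density_potentialD(3)[OF assms(2), of y] density_potentialD(3)[OF assms(3), of y]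
  ultimately show ?thesis
    by eventually_elim simp
qed

lemma log_derivative_AE_eq:
  assumes A: "banach_manifold A" and fin: "finite_measure \<mu>"
    and q: "density_potential k A \<mu> p q" and q': "density_potential k A \<mu> p q'"
    and v: "v \<in> tangent_space A x"
  shows "AE \<omega> in \<mu>. log_derivative A q x v \<omega> = log_derivative A q' x v \<omega>"
proof -
  obtain c where c: "c \<in> charts_at A x"
    using A unfolding banach_manifold_def charts_at_def by fastforce
  define t where "t n = inverse (real (Suc n))" for n
  define y where "y s = chart_inv c (snd c x + s *\<^sub>R v c)" for s
  have "AE \<omega> in \<mu>. \<forall>n. q (y (t n)) \<omega> = q' (y (t n)) \<omega>"
    using density_potential_AE_eq[OF fin q q'] by (simp add: AE_all_countable)
  moreover note density_potential_AE_eq[OF fin q q', of "y 0"]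
  moreover note density_potentialD(4)[OF q] density_potentialD(4)[OF q']
  ultimately show ?thesis
  proof eventually_elim
    case (elim \<omega>)
    obtain d where d: "has_gateaux_derivative A (\<lambda>x. ln (q x \<omega>)) x v d"
      using elim(3) v unfolding continuously_gateaux_differentiable_def by blast
    obtain d' where d': "has_gateaux_derivative A (\<lambda>x. ln (q' x \<omega>)) x v d'"
      using elim(4) v unfolding continuously_gateaux_differentiable_def by blast
    have t: "filterlim t (at 0) sequentially"
      unfolding filterlim_at using LIMSEQ_inverse_real_of_nat by (auto simp: t_def [abs_def])
    have 1: "(\<lambda>n. (ln (q (y (t n)) \<omega>) - ln (q (y 0) \<omega>)) / t n) \<longlonglongrightarrow> d"
      using d c filterlim_compose[OF _ t] unfolding has_gateaux_derivative_def y_def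
      by (fastforce simp: has_field_derivative_iff)
    have 2: "(\<lambda>n. (ln (q' (y (t n)) \<omega>) - ln (q' (y 0) \<omega>)) / t n) \<longlonglongrightarrow> d'"
      using d' c filterlim_compose[OF _ t] unfolding has_gateaux_derivative_def y_def
      by (fastforce simp: has_field_derivative_iff)
    have "d = d'"
      using LIMSEQ_unique[OF 1] 2 elim(1,2) by simp
    then show ?case
      using has_gateaux_derivative_imp_eq[OF A d] has_gateaux_derivative_imp_eq[OF A d']
      by (simp add: log_derivative_def)
  qed
qed

lemma borel_measurable_completion_AE:
  fixes f g :: "'a \<Rightarrow> real"
  assumes "f \<in> borel_measurable (completion \<nu>)" "AE \<omega> in \<nu>. f \<omega> = g \<omega>"
  shows "g \<in> borel_measurable (completion \<nu>)"
proof -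
  obtain N where N: "N \<in> null_sets \<nu>" "{\<omega> \<in> space \<nu>. f \<omega> \<noteq> g \<omega>} \<subseteq> N"
    using assms(2) by (auto simp: eventually_ae_filter)
  show ?thesis
  proof (rule measurableI)
    fix B :: "real set" assume B: "B \<in> sets borel"
    have sub: "X \<in> sets (completion \<nu>)" if "X \<subseteq> N" for X
      using null_sets_completion[OF N(1) that] .
    have "g -` B \<inter> space \<nu> = (f -` B \<inter> space \<nu> - N) \<union> (g -` B \<inter> space \<nu> \<inter> N)"
      using N by auto
    moreover have "f -` B \<inter> space \<nu> - N \<in> sets (completion \<nu>)"
      using measurable_sets[OF assms(1) B] sub[of N] by auto
    ultimately show "g -` B \<inter> space (completion \<nu>) \<in> sets (completion \<nu>)"
      using sub[of "g -` B \<inter> space \<nu> \<inter> N"] by (metis inf_le2 sets.Un space_completion)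
  qed simp
qed

lemma integral_completion_cong_AE:
  fixes f g :: "'a \<Rightarrow> real"
  assumes AE: "AE \<omega> in \<nu>. f \<omega> = g \<omega>"
  shows "(\<integral>\<omega>. f \<omega> \<partial>completion \<nu>) = (\<integral>\<omega>. g \<omega> \<partial>completion \<nu>)"
proof (cases "f \<in> borel_measurable (completion \<nu>)")
  case True
  then show ?thesis
    using borel_measurable_completion_AE[OF True AE] AE_completion[OF AE]
    by (intro integral_cong_AE)
next
  case False
  have "AE \<omega> in \<nu>. g \<omega> = f \<omega>"
    using AE by eventually_elim simp
  with False have "g \<notin> borel_measurable (completion \<nu>)"
    using borel_measurable_completion_AE by blast
  with False show ?thesis
    by (metis borel_measurable_integrable not_integrable_integral_eq)
qed

theorem fisher_form_eq:
  assumes A: "banach_manifold A" and fin: "finite_measure \<mu>"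
    and q: "density_potential 2 A \<mu> p q"
    and V: "V \<in> tangent_space A x" and W: "W \<in> tangent_space A x"
  shows "fisher_form A \<mu> p x V W =
    (\<integral>\<omega>. log_derivative A q x V \<omega> * log_derivative A q x W \<omega> \<partial>completion (p x))"
proof -
  define q' where "q' = (SOME q. density_potential 2 A \<mu> p q)"
  have q': "density_potential 2 A \<mu> p q'"
    unfolding q'_def by (rule someI[of _ q]) (rule q)
  have "AE \<omega> in \<mu>. log_derivative A q' x V \<omega> * log_derivative A q' x W \<omega>
          = log_derivative A q x V \<omega> * log_derivative A q x W \<omega>"
    using log_derivative_AE_eq[OF A fin q' q V] log_derivative_AE_eq[OF A fin q' q W]
    by eventually_elim simp
  then have "AE \<omega> in p x. log_derivative A q' x V \<omega> * log_derivative A q' x W \<omega>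
          = log_derivative A q x V \<omega> * log_derivative A q x W \<omega>"
    unfolding density_potentialD(2)[OF q, of x]
    using density_potentialD(1)[OF q, of x] by (subst AE_density) auto
  then show ?thesis
    unfolding fisher_form_def Let_def q'_def[symmetric]
    by (rule integral_completion_cong_AE)
qed

end

theory Submission
  imports Defs
begin

text \<open>
  Let \<open>y\<close> be the straight line in a chart that represents the tangent vector \<open>V\<close>, and put
  \<open>f\<^sub>t = q1 (y t)\<close> and \<open>g\<^sub>t = q2 (y t)\<close> for density potentials of the two models. The Hellinger
  quotient \<open>\<integral> (2 (sqrt g\<^sub>s - sqrt g\<^sub>0) / s)\<^sup>2\<close> dominates the Fisher form of the image model as \<open>s \<rightarrow> 0\<close>,
  by Fatou; the Hellinger distance decreases under \<open>\<kappa>\<close>; and the quotient for \<open>f\<close> is at most an average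
  over \<open>[0, s]\<close> of the squared \<open>L\<^sup>2\<close> norms of the logarithmic derivatives along \<open>y\<close>. Extending \<open>V\<close> to a
  continuous vector field, these norms depend continuously on \<open>t\<close> by condition (2), so this
  average tends to the Fisher form of the original model.
\<close>

section \<open>Charts and tangent vectors\<close>

text \<open>The remainder estimate at order 0 is Frechet differentiability with derivative
  \<open>D 1 x [v]\<close>. The estimate at order 1, combined with the bound on
  \<open>D 2 x\<close>, makes this derivative continuous in \<open>x\<close> for each fixed
  \<open>v\<close>; that is the form of continuity that the construction of continuous vector fields
  uses.\<close>

lemma frechet_smooth_on_has_derivative:
  fixes f :: "'a::real_normed_vector \<Rightarrow> 'b::real_normed_vector"
  assumes "frechet_smooth_on S f" "open S"
  obtains f' where "\<And>x. x \<in> S \<Longrightarrow> (f has_derivative f' x) (at x)"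
    "\<And>v. continuous_on S (\<lambda>x. f' x v)"
proof -
  obtain D :: "nat \<Rightarrow> 'a \<Rightarrow> 'a list \<Rightarrow> 'b" where
    D0: "\<And>x. x \<in> S \<Longrightarrow> D 0 x [] = f x" and
    ml: "\<And>n x. x \<in> S \<Longrightarrow> bounded_multilinear n (D n x)" and
    D: "\<And>n x e. x \<in> S \<Longrightarrow> e > 0 \<Longrightarrow> \<exists>d>0. \<forall>y\<in>S. dist y x < d \<longrightarrow>
           (\<forall>vs. length vs = n \<longrightarrow>
              norm (D n y vs - D n x vs - D (Suc n) x ((y - x) # vs))
                \<le> e * norm (y - x) * prod_list (map norm vs))"
    using assms(1) unfolding frechet_smooth_on_def by metis
  show thesis
  proof
    fix x assume x: "x \<in> S"
    have "bounded_linear (\<lambda>v. D 1 x [v])"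
    proof -
      have "\<forall>vs i. length vs = 1 \<and> i < 1 \<longrightarrow> linear (\<lambda>v. D 1 x (vs[i := v]))"
        using ml[OF x, of 1] unfolding bounded_multilinear_def by blast
      \<comment> \<open>The entry of \<open>[0]\<close> is a placeholder: the list update overwrites
        it by \<open>v\<close>.\<close>
      from this[rule_format, of "[0]" 0] have lin: "linear (\<lambda>v. D 1 x [v])" by simp
      obtain C where "\<And>vs. length vs = 1 \<Longrightarrow> norm (D 1 x vs) \<le> C * prod_list (map norm vs)"
        using ml[OF x, of 1] unfolding bounded_multilinear_def by blast
      from this[of "[_]"] have "\<And>v. norm (D 1 x [v]) \<le> norm v * C" by (simp add: mult.commute)
      then show ?thesis
        using lin by (intro bounded_linear_intro[of _ C]) (auto simp: linear_add[OF lin] linear_scale[OF lin] simp del: One_nat_def)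
    qed
    moreover have "\<exists>d>0. \<forall>y\<in>S. norm (y - x) < d \<longrightarrow> norm (f y - f x - D 1 x [y - x]) \<le> e * norm (y - x)"
      if "e > 0" for e
      using D[OF x that, of 0] D0 x by (auto simp: dist_norm)
    ultimately have "(f has_derivative (\<lambda>v. D 1 x [v])) (at x within S)"
      unfolding has_derivative_within_alt by blast
    then show "(f has_derivative (\<lambda>v. D 1 x [v])) (at x)"
      using at_within_open[OF x assms(2)] by simp
  next
    fix v
    show "continuous_on S (\<lambda>x. D 1 x [v])"
      unfolding continuous_on_def
    proof
      fix x assume x: "x \<in> S"
      obtain C where C: "\<And>vs. length vs = 2 \<Longrightarrow> norm (D 2 x vs) \<le> C * prod_list (map norm vs)"
        using ml[OF x, of 2] unfolding bounded_multilinear_def by blast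
      obtain d where d: "d > 0" and *: "\<And>y vs. y \<in> S \<Longrightarrow> dist y x < d \<Longrightarrow> length vs = 1 \<Longrightarrow>
            norm (D 1 y vs - D 1 x vs - D 2 x ((y - x) # vs)) \<le> 1 * norm (y - x) * prod_list (map norm vs)"
        using D[OF x zero_less_one, of 1] by (auto simp: numeral_2_eq_2)
      \<comment> \<open>In \<open>C + 1\<close> the summand \<open>C\<close> bounds
        \<open>D 2 x [y - x, v]\<close>, and the summand 1 is the tolerance chosen for the
        remainder.\<close>
      have bnd: "norm (D 1 y [v] - D 1 x [v]) \<le> (C + 1) * norm v * norm (y - x)"
        if "y \<in> S" "dist y x < d" for y
        using *[OF that, of "[v]"] C[of "[y - x, v]"]
          norm_triangle_sub[of "D 1 y [v] - D 1 x [v]" "D 2 x [y - x, v]"]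
        by (simp add: algebra_simps)
      have ev: "\<forall>\<^sub>F y in at x within S. norm (D 1 y [v] - D 1 x [v]) \<le> (C + 1) * norm v * norm (y - x)"
        unfolding eventually_at using d bnd by blast
      have "((\<lambda>y. (C + 1) * norm v * norm (y - x)) \<longlongrightarrow> (C + 1) * norm v * norm (x - x)) (at x within S)"
        by (intro tendsto_intros)
      then have "((\<lambda>y. D 1 y [v] - D 1 x [v]) \<longlongrightarrow> 0) (at x within S)"
        by (intro Lim_null_comparison[OF ev]) simp
      then show "((\<lambda>y. D 1 y [v]) \<longlongrightarrow> D 1 x [v]) (at x within S)"
        by (simp add: LIM_zero_iff)
    qed
  qed
qed

section \<open>Charts and coordinate changes\<close>

lemma
  assumes "banach_manifold A" "c \<in> A"
  shows open_chart_domain: "open (fst c)"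
    and chart_homeomorphism: "homeomorphism (fst c) (snd c ` fst c) (snd c) (chart_inv c)"
    and open_chart_range: "open (snd c ` fst c)"
  using assms unfolding banach_manifold_def by auto

lemma chart_inv_chart:
  assumes "banach_manifold A" "c \<in> A" "z \<in> fst c"
  shows "chart_inv c (snd c z) = z"
  using chart_homeomorphism[OF assms(1,2)] assms(3) by (simp add: homeomorphism_def)

lemma chart_chart_inv:
  assumes "banach_manifold A" "c \<in> A" "u \<in> snd c ` fst c"
  shows "chart_inv c u \<in> fst c" "snd c (chart_inv c u) = u"
  using chart_inv_chart[OF assms(1,2)] assms(3) by auto

lemma open_chart_image:
  assumes "banach_manifold A" "c \<in> A" "open U" "U \<subseteq> fst c"
  shows "open (snd c ` U)"
proof -
  have "openin (top_of_set (snd c ` fst c)) (snd c ` U)"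
    using assms open_chart_domain[OF assms(1,2)]
    by (intro homeomorphism_imp_open_map[OF chart_homeomorphism[OF assms(1,2)]])
       (simp add: openin_open_eq)
  then show ?thesis
    using open_chart_range[OF assms(1,2)] by (simp add: openin_open_eq)
qed

lemma transition_smooth:
  assumes A: "banach_manifold A" "c \<in> A" "c' \<in> A"
  obtains D where
    "\<And>z. z \<in> fst c \<inter> fst c' \<Longrightarrow> ((snd c' \<circ> chart_inv c) has_derivative D (snd c z)) (at (snd c z))"
    "\<And>v. continuous_on (snd c ` (fst c \<inter> fst c')) (\<lambda>u. D u v)"
proof -
  have "frechet_smooth_on (snd c ` (fst c \<inter> fst c')) (snd c' \<circ> chart_inv c)"
    using A unfolding banach_manifold_def by blast
  moreover have "open (snd c ` (fst c \<inter> fst c'))"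
    by (rule open_chart_image[OF A(1,2)]) (simp_all add: open_Int open_chart_domain[OF A(1)] A)
  ultimately show thesis
    using that by (elim frechet_smooth_on_has_derivative) blast+
qed

lemma transition_has_derivative:
  assumes "banach_manifold A" "c \<in> A" "c' \<in> A" "z \<in> fst c" "z \<in> fst c'"
  shows "((snd c' \<circ> chart_inv c) has_derivative
    frechet_derivative (snd c' \<circ> chart_inv c) (at (snd c z))) (at (snd c z))"
  using transition_smooth[OF assms(1-3)] assms(4,5)
  by (metis IntI differentiableI frechet_derivative_works)

section \<open>Compatibility of the coordinates of a tangent vector\<close>

lemma tangent_vector_at:
  assumes "c' \<in> A" "z \<in> fst c'"
  shows "tangent_vector A c z w c' = frechet_derivative (snd c' \<circ> chart_inv c) (at (snd c z)) w"
  using assms by (simp add: tangent_vector_def charts_at_def)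

lemma tangent_vector_same_chart:
  assumes A: "banach_manifold A" "c \<in> A" "z \<in> fst c"
  shows "tangent_vector A c z w c = w"
proof -
  have "((\<lambda>u. u) has_derivative (\<lambda>w. w)) (at (snd c z))"
    by (rule has_derivative_ident)
  then have "((snd c \<circ> chart_inv c) has_derivative (\<lambda>w. w)) (at (snd c z))"
    by (rule has_derivative_transform_within_open[OF _ open_chart_range[OF A(1,2)]])
      (use A(3) chart_chart_inv(2)[OF A(1,2)] in auto)
  then show ?thesis
    using A by (simp add: tangent_vector_at frechet_derivative_at[symmetric])
qed

text \<open>This is the cocycle property of coordinate changes: passing from \<open>c\<close> to
  \<open>c2\<close> through \<open>c1\<close> is the same as passing directly, and the chain rule
  carries this over to derivatives.\<close>

lemma tangent_vector_in_tangent_space: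
  assumes A: "banach_manifold A" "c \<in> A" "z \<in> fst c"
  shows "tangent_vector A c z w \<in> tangent_space A z"
  unfolding tangent_space_def
proof (intro CollectI ballI ext)
  fix c1 c2 assume "c1 \<in> charts_at A z"
  then have c1: "c1 \<in> A" "z \<in> fst c1" by (auto simp: charts_at_def)
  show "tangent_vector A c z w c2 = tangent_vector A c1 z (tangent_vector A c z w c1) c2"
  proof (cases "c2 \<in> charts_at A z")
    case True
    then have c2: "c2 \<in> A" "z \<in> fst c2" by (auto simp: charts_at_def)
    let ?D = "\<lambda>c c'. frechet_derivative (snd c' \<circ> chart_inv c) (at (snd c z))"
    have z: "(snd c1 \<circ> chart_inv c) (snd c z) = snd c1 z"
      using chart_inv_chart[OF A] by simp
    have "((snd c2 \<circ> chart_inv c1) \<circ> (snd c1 \<circ> chart_inv c) has_derivative ?D c1 c2 \<circ> ?D c c1)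
        (at (snd c z))"
      using transition_has_derivative[OF A(1,2) c1(1) A(3) c1(2)]
        transition_has_derivative[OF A(1) c1(1) c2(1) c1(2) c2(2)]
      by (intro diff_chain_at) (simp_all only: z)
    \<comment> \<open>On this open set \<open>chart_inv c1\<close> cancels \<open>snd c1\<close>, so
      the composite agrees with the direct coordinate change near \<open>snd c z\<close>, and both
      have the same derivative there.\<close>
    moreover have "open (snd c ` (fst c \<inter> fst c1))"
      by (rule open_chart_image[OF A(1,2)]) (simp_all add: open_Int open_chart_domain[OF A(1)] A c1)
    ultimately have "(snd c2 \<circ> chart_inv c has_derivative ?D c1 c2 \<circ> ?D c c1) (at (snd c z))"
      by (rule has_derivative_transform_within_open)
        (use A c1 chart_inv_chart[OF A(1,2)] chart_inv_chart[OF A(1) c1(1)] in auto)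
    then have "?D c c2 = ?D c1 c2 \<circ> ?D c c1"
      by (rule frechet_derivative_at[symmetric])
    then show ?thesis
      using c1 c2 by (simp add: tangent_vector_at)
  qed (simp add: tangent_vector_def)
qed

lemma zero_in_tangent_space:
  assumes A: "banach_manifold A"
  shows "(\<lambda>_. 0) \<in> tangent_space A z"
  unfolding tangent_space_def
proof (intro CollectI ballI ext)
  fix c1 c2 assume "c1 \<in> charts_at A z"
  then have c1: "c1 \<in> A" "z \<in> fst c1" by (auto simp: charts_at_def)
  show "0 = tangent_vector A c1 z 0 c2"
    using transition_has_derivative[OF A c1(1) _ c1(2), of c2]
    by (auto simp: tangent_vector_def charts_at_def dest: has_derivative_linear linear_0)
qed

section \<open>Extension of tangent vectors to continuous vector fields\<close>

lemma chart_bump_function: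
  fixes A :: "('m::t3_space, 'e::banach) chart set"
  assumes A: "banach_manifold A" "c \<in> A" "x \<in> fst c"
  obtains \<rho> :: "'m \<Rightarrow> real" and C W where
    "continuous_on UNIV \<rho>" "closed C" "C \<subseteq> fst c" "\<And>z. z \<notin> C \<Longrightarrow> \<rho> z = 0"
    "open W" "x \<in> W" "W \<subseteq> fst c" "\<And>z. z \<in> W \<Longrightarrow> \<rho> z = 1"
proof -
  note U = open_chart_domain[OF A(1,2)]
  have cont: "continuous_on (fst c) (snd c)"
    using chart_homeomorphism[OF A(1,2)] by (simp add: homeomorphism_def)
  \<comment> \<open>Regularity of the topology separates \<open>x\<close> from the complement of the
    chart domain. The closure of \<open>P\<close> avoids the open set \<open>Q\<close> and therefore
    stays inside the chart domain.\<close>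
  obtain P Q where PQ: "open P" "open Q" "x \<in> P" "- fst c \<subseteq> Q" "P \<inter> Q = {}"
    using t3_space[of "- fst c" x] U A(3) by auto
  then have PU: "P \<subseteq> fst c" and clP: "closure P \<subseteq> fst c"
    using closure_minimal[of P "- Q"] by (auto simp: closed_Compl)
  obtain r where r: "r > 0" "ball (snd c x) r \<subseteq> snd c ` P"
    using open_chart_image[OF A(1,2) PQ(1) PU] PQ(3) by (meson imageI openE)
  define C where "C = {z \<in> P. dist (snd c x) (snd c z) \<le> r / 2}"
  define W where "W = {z \<in> P. dist (snd c x) (snd c z) < r / 4}"
  \<comment> \<open>A truncated affine function of the coordinate distance to
    \<open>snd c x\<close>: it is 1 up to distance \<open>r / 4\<close> and 0 from distance
    \<open>r / 2\<close> on.\<close>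
  define \<rho> where "\<rho> z = (if z \<in> fst c \<inter> P then min 1 (max 0 (2 - 4 / r * dist (snd c x) (snd c z))) else 0)" for z
  have contP: "continuous_on P (snd c)"
    using cont PU continuous_on_subset by blast
  \<comment> \<open>\<open>C\<close> must be closed in the whole manifold, not only relative to the
    chart, for the extension of \<open>\<rho>\<close> by 0 to be continuous. A limit point of
    \<open>C\<close> still lies in the chart domain, and its coordinate distance is at most
    \<open>r / 2 < r\<close>, so its coordinates lie in the image of \<open>P\<close>; injectivity
    of the chart puts it in \<open>P\<close>.\<close>
  have "closed C"
  proof -
    have "closure C \<subseteq> C"
    proof
      fix z assume z: "z \<in> closure C"
      have "z \<in> closure P"
        using z closure_mono[of C P] by (auto simp: C_def)
      then have zU: "z \<in> fst c" using clP by blast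
      have clC: "closure C \<subseteq> fst c"
        using clP closure_mono[of C P] by (auto simp: C_def)
      have "dist (snd c x) (snd c z) \<le> r / 2"
      proof (rule continuous_le_on_closure[OF _ z])
        show "continuous_on (closure C) (\<lambda>z. dist (snd c x) (snd c z))"
          using continuous_on_subset[OF cont clC] by (intro continuous_intros)
      qed (simp add: C_def)
      moreover from this have "snd c z \<in> snd c ` P"
        using r by (intro subsetD[OF r(2)]) auto
      then have "z \<in> P"
        using zU PU chart_inv_chart[OF A(1,2)] by (metis imageE subsetD)
      ultimately show "z \<in> C" by (simp add: C_def)
    qed
    then show ?thesis by (simp add: closure_subset_eq)
  qed
  have 0: "\<rho> z = 0" if "z \<notin> C" for z
    using that r(1) by (auto simp: \<rho>_def C_def field_simps min_def max_def)
  \<comment> \<open>Both sets are open: on \<open>P\<close> the truncated formula is continuous, and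
    off \<open>C\<close> the function is constantly 0.\<close>
  have "continuous_on (P \<union> - C) \<rho>"
  proof (rule continuous_on_open_Un)
    have "continuous_on P (\<lambda>z. min 1 (max 0 (2 - 4 / r * dist (snd c x) (snd c z))))"
      using contP by (intro continuous_intros)
    then show "continuous_on P \<rho>"
      using PU by (elim continuous_on_eq) (auto simp: \<rho>_def)
    have "continuous_on (- C) (\<lambda>_. 0 :: real)" by simp
    then show "continuous_on (- C) \<rho>"
      using 0 by (elim continuous_on_eq) auto
  qed (use PQ \<open>closed C\<close> in auto)
  moreover have "P \<union> - C = UNIV" by (auto simp: C_def)
  ultimately have "continuous_on UNIV \<rho>" by simp
  moreover have "open W"
  proof -
    have "open (P \<inter> (\<lambda>z. dist (snd c x) (snd c z)) -` {..< r / 4})"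
      using contP PQ(1) by (intro continuous_open_preimage continuous_intros) auto
    then show ?thesis by (simp add: W_def Int_def vimage_def)
  qed
  moreover have "\<rho> z = 1" if "z \<in> W" for z
    using that PU r(1) by (auto simp: \<rho>_def W_def field_simps min_def max_def)
  ultimately show thesis
    using \<open>closed C\<close> 0 PU PQ(3) r(1) by (intro that[of \<rho> C W]) (auto simp: C_def W_def)
qed

text \<open>The field with constant coordinates \<open>w\<close> in \<open>c\<close> is multiplied
  by a bump function and extended by 0. In any other chart \<open>c'\<close> its coordinates are
  continuous on two open sets that cover the domain of \<open>c'\<close>: on the overlap with
  \<open>c\<close>, by continuity of the derivative of the coordinate change, and off the closed set
  \<open>C\<close>, where they vanish.\<close>

lemma tangent_vector_extension:
  fixes A :: "('m::t3_space, 'e::banach) chart set"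
  assumes A: "banach_manifold A" "c \<in> A" "x \<in> fst c"
  obtains X W where "continuous_vector_field A X" "open W" "x \<in> W" "W \<subseteq> fst c"
    "\<And>z. z \<in> W \<Longrightarrow> X z = tangent_vector A c z w"
proof -
  obtain \<rho> :: "'m \<Rightarrow> real" and C W where
    \<rho>: "continuous_on UNIV \<rho>" "closed C" "C \<subseteq> fst c" "\<And>z. z \<notin> C \<Longrightarrow> \<rho> z = 0"
    and W: "open W" "x \<in> W" "W \<subseteq> fst c" "\<And>z. z \<in> W \<Longrightarrow> \<rho> z = 1"
    using chart_bump_function[OF A] by blast
  define X where "X z = (if z \<in> fst c then tangent_vector A c z (\<rho> z *\<^sub>R w) else (\<lambda>_. 0))" for z
  have "continuous_on (fst c') (\<lambda>z. X z c')" if c': "c' \<in> A" for c'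
  proof -
    obtain D where D:
      "\<And>z. z \<in> fst c \<inter> fst c' \<Longrightarrow> ((snd c' \<circ> chart_inv c) has_derivative D (snd c z)) (at (snd c z))"
      "\<And>v. continuous_on (snd c ` (fst c \<inter> fst c')) (\<lambda>u. D u v)"
      using transition_smooth[OF A(1,2) c'] by metis
    have X: "X z c' = \<rho> z *\<^sub>R D (snd c z) w" if "z \<in> fst c \<inter> fst c'" for z
      using that c' frechet_derivative_at[OF D(1)[OF that]]
        linear_scale[OF has_derivative_linear[OF D(1)[OF that]]]
      by (simp add: X_def tangent_vector_at)
    have X0: "X z c' = 0" if "z \<in> fst c'" "z \<notin> C" for z
    proof (cases "z \<in> fst c")
      case True
      with that X[of z] \<rho>(4) show ?thesis by simp
    qed (simp add: X_def)
    have o: "open (fst c)" "open (fst c')"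
      using open_chart_domain[OF A(1)] A c' by auto
    have "continuous_on ((fst c \<inter> fst c') \<union> (fst c' - C)) (\<lambda>z. X z c')"
    proof (rule continuous_on_open_Un)
      have "continuous_on (fst c \<inter> fst c') (snd c)"
        using chart_homeomorphism[OF A(1,2)] continuous_on_subset
        by (fastforce simp: homeomorphism_def)
      then have "continuous_on (fst c \<inter> fst c') (\<lambda>z. \<rho> z *\<^sub>R D (snd c z) w)"
        using \<rho>(1) continuous_on_subset
        by (intro continuous_intros continuous_on_compose2[OF D(2)]) blast+
      then show "continuous_on (fst c \<inter> fst c') (\<lambda>z. X z c')"
        using X by (elim continuous_on_eq) simp
      have "continuous_on (fst c' - C) (\<lambda>_. 0 :: 'e)" by simp
      then show "continuous_on (fst c' - C) (\<lambda>z. X z c')"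
        using X0 by (elim continuous_on_eq) simp
    qed (use o \<rho>(2) in auto)
    moreover have "(fst c \<inter> fst c') \<union> (fst c' - C) = fst c'" using \<rho>(3) by auto
    ultimately show ?thesis by simp
  qed
  moreover have "X z \<in> tangent_space A z" for z
    using zero_in_tangent_space[OF A(1)] tangent_vector_in_tangent_space[OF A(1,2)]
    by (simp add: X_def)
  ultimately have "continuous_vector_field A X"
    by (simp add: continuous_vector_field_def)
  then show thesis
    using W by (intro that[of X W]) (auto simp: X_def)
qed

text \<open>The Gateaux differential at a point only gives the derivative at parameter 0 of a line
  that starts there. Restarting the line at \<open>y t\<close> keeps the direction \<open>w\<close>,
  which is the coordinate in \<open>c\<close> of the tangent vector at \<open>y t\<close>, so a
  shift of the parameter gives the derivative at every \<open>t\<close>. Continuity is inherited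
  from the tangent bundle along \<open>t \<mapsto> (y t, w)\<close>.\<close>

lemma gateaux_derivative_along_line:
  assumes A: "banach_manifold A" "c \<in> A"
    and f: "continuously_gateaux_differentiable A f"
    and I: "\<And>t. t \<in> I \<Longrightarrow> u + t *\<^sub>R w \<in> snd c ` fst c"
    and y: "\<And>t. y t = chart_inv c (u + t *\<^sub>R w)"
  shows "t \<in> I \<Longrightarrow> ((\<lambda>s. f (y s)) has_real_derivative
      gateaux_derivative A f (y t) (tangent_vector A c (y t) w)) (at t)"
    and "continuous_on I (\<lambda>t. gateaux_derivative A f (y t) (tangent_vector A c (y t) w))"
proof -
  have yc: "y t \<in> fst c" "snd c (y t) = u + t *\<^sub>R w" if "t \<in> I" for t
    using chart_chart_inv[OF A I[OF that]] by (auto simp: y)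
  {
    fix t assume t: "t \<in> I"
    let ?v = "tangent_vector A c (y t) w"
    obtain d where d: "has_gateaux_derivative A f (y t) ?v d"
      using f tangent_vector_in_tangent_space[OF A yc(1)[OF t]]
      unfolding continuously_gateaux_differentiable_def by blast
    then have "((\<lambda>s. f (chart_inv c (snd c (y t) + s *\<^sub>R ?v c))) has_real_derivative d) (at 0)"
      using A(2) yc(1)[OF t] unfolding has_gateaux_derivative_def charts_at_def by blast
    then have "((\<lambda>s. f (y (t + s))) has_real_derivative d) (at 0)"
      using tangent_vector_same_chart[OF A yc(1)[OF t]]
      by (simp add: yc(2)[OF t]) (simp add: y algebra_simps)
    then have "((\<lambda>s. f (y s)) has_real_derivative d) (at t)"
      using DERIV_shift[of "\<lambda>s. f (y s)" d 0 t] by (simp add: add.commute)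
    then show "((\<lambda>s. f (y s)) has_real_derivative gateaux_derivative A f (y t) ?v) (at t)"
      using has_gateaux_derivative_imp_eq[OF A(1) d] by simp
  }
  have "continuous_on (snd c ` fst c) (chart_inv c)"
    using chart_homeomorphism[OF A] by (simp add: homeomorphism_def)
  then have "continuous_on I y"
    unfolding y[abs_def] by (rule continuous_on_compose2) (use I in \<open>auto intro!: continuous_intros\<close>)
  moreover have "continuous_on (fst c \<times> UNIV)
      (\<lambda>(z, w). gateaux_derivative A f z (tangent_vector A c z w))"
    using f A(2) unfolding continuously_gateaux_differentiable_def continuous_on_tangent_bundle_def
    by blast
  ultimately show "continuous_on I (\<lambda>t. gateaux_derivative A f (y t) (tangent_vector A c (y t) w))"
    using continuous_on_compose2[of "fst c \<times> UNIV"
        "\<lambda>(z, w). gateaux_derivative A f z (tangent_vector A c z w)" I "\<lambda>t. (y t, w)"] yc(1)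
    by (simp add: continuous_on_Pair image_subset_iff)
qed

section \<open>Increments and Hellinger distances\<close>

text \<open>By the mean value theorem the increment of \<open>F\<close> over a subinterval of length
  \<open>h\<close> is \<open>h * G z\<close> for some inner point \<open>z\<close>; uniform
  continuity of \<open>G\<close> allows \<open>z\<close> to be replaced by the left endpoint, and
  the increments telescope.\<close>

lemma riemann_sums_converge:
  fixes F :: "real \<Rightarrow> real"
  assumes s: "0 < s"
    and F: "\<And>t. t \<in> {0..s} \<Longrightarrow> (F has_real_derivative G t) (at t)"
    and G: "continuous_on {0..s} G"
  shows "(\<lambda>n. s / Suc n * (\<Sum>i\<le>n. G (real i * s / real (Suc n)))) \<longlonglongrightarrow> F s - F 0"
proof (rule LIMSEQ_I)
  fix e :: real assume e: "e > 0"
  \<comment> \<open>The errors \<open>h * e'\<close> add up to \<open>s * e' = e / 2\<close> over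
    the \<open>Suc n\<close> subintervals.\<close>
  define e' where "e' = e / (2 * s)"
  have e': "e' > 0" using e s by (simp add: e'_def)
  have "uniformly_continuous_on {0..s} G"
    using G compact_uniformly_continuous by blast
  then obtain d where d: "d > 0" "\<And>t t'::real. t \<in> {0..s} \<Longrightarrow> t' \<in> {0..s} \<Longrightarrow> \<bar>t' - t\<bar> < d \<Longrightarrow> \<bar>G t' - G t\<bar> < e'"
    using e' unfolding uniformly_continuous_on_def dist_real_def by metis
  \<comment> \<open>This makes the mesh \<open>s / Suc n\<close> smaller than \<open>d\<close> for
    all \<open>n \<ge> N\<close>.\<close>
  obtain N where N: "s / d < real N" using reals_Archimedean2 by blast
  have "\<bar>s / Suc n * (\<Sum>i\<le>n. G (real i * s / real (Suc n))) - (F s - F 0)\<bar> < e" if n: "n \<ge> N" for n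
  proof -
    define h where "h = s / Suc n"
    have h: "h > 0" "h < d" 
    proof -
      show "h > 0" using s by (simp add: h_def)
      have "s / d < Suc n" using N n by linarith
      then show "h < d" using d(1) by (simp add: h_def field_simps)
    qed
    have 1: "\<bar>h * G (real i * h) - (F (real (Suc i) * h) - F (real i * h))\<bar> \<le> h * e'" if i: "i \<le> n" for i
    proof -
      have le: "Suc i * h \<le> s"
      proof -
        have "Suc i * h \<le> Suc n * h" using i h by (intro mult_right_mono) auto
        then show ?thesis by (simp add: h_def)
      qed
      have lt: "i * h < Suc i * h" using h(1) by (intro mult_strict_right_mono) auto
      have in_s: "t \<in> {0..s}" if "i * h \<le> t" "t \<le> Suc i * h" for t
      proof -
        have "0 \<le> i * h" using h(1) by simp
        then have "0 \<le> t" using that(1) by linarith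
        then show ?thesis using that(2) le by simp
      qed
      obtain z where z: "i * h < z" "z < Suc i * h" "F (real (Suc i) * h) - F (real i * h) = (Suc i * h - i * h) * G z"
        using MVT2[OF lt, of F G] F in_s by blast
      have eq: "Suc i * h - i * h = h" by (simp add: algebra_simps)
      have "\<bar>z - i * h\<bar> < d" using z(1,2) eq h(2) by linarith
      then have "\<bar>G z - G (real i * h)\<bar> < e'"
        using z(1,2) lt by (intro d(2) in_s) auto
      then have "h * \<bar>G z - G (real i * h)\<bar> \<le> h * e'" using h by (intro mult_left_mono) auto
      moreover have "h * G (real i * h) - (F (real (Suc i) * h) - F (real i * h)) = h * (G (real i * h) - G z)"
        unfolding z(3) eq by (simp add: algebra_simps)
      ultimately show ?thesis
        using h(1) by (simp add: abs_mult abs_minus_commute)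
    qed
    have "(\<Sum>i\<le>n. F (real (Suc i) * h) - F (real i * h)) = F (Suc n * h) - F (0 * h)"
      using sum_lessThan_telescope[of "\<lambda>i. F (real i * h)" "Suc n"] by (simp add: lessThan_Suc_atMost)
    moreover have hs: "Suc n * h = s" by (simp add: h_def)
    ultimately have "s / Suc n * (\<Sum>i\<le>n. G (real i * s / real (Suc n))) - (F s - F 0)
        = (\<Sum>i\<le>n. h * G (real i * h) - (F (real (Suc i) * h) - F (real i * h)))"
      by (simp add: sum_subtractf sum_distrib_left h_def)
    also have "\<bar>\<dots>\<bar> \<le> (\<Sum>i\<le>n. h * e')"
      by (rule order_trans[OF sum_abs sum_mono]) (rule 1, simp)
    also have "\<dots> = real (Suc n) * h * e'" by simp
    also have "\<dots> = e / 2" unfolding hs using s by (simp add: e'_def)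
    finally show ?thesis using e by simp
  qed
  then show "\<exists>N. \<forall>n\<ge>N. norm (s / Suc n * (\<Sum>i\<le>n. G (real i * s / real (Suc n))) - (F s - F 0)) < e"
    by auto
qed

text \<open>Fatou's lemma for squares: a bound on the L2 norms passes to an almost everywhere limit
  without any dominating function. It serves both for the Riemann sums and for the Hellinger
  quotients.\<close>

lemma nn_integral_square_tendsto_le:
  fixes f :: "nat \<Rightarrow> 'a \<Rightarrow> real"
  assumes [measurable]: "\<And>n. f n \<in> borel_measurable M"
    and lim: "AE \<omega> in M. (\<lambda>n. f n \<omega>) \<longlonglongrightarrow> g \<omega>"
    and le: "\<forall>\<^sub>F n in sequentially. (\<integral>\<^sup>+\<omega>. ennreal ((f n \<omega>)\<^sup>2) \<partial>M) \<le> B"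
  shows "(\<integral>\<^sup>+\<omega>. ennreal ((g \<omega>)\<^sup>2) \<partial>M) \<le> B"
proof -
  have "(\<integral>\<^sup>+\<omega>. ennreal ((g \<omega>)\<^sup>2) \<partial>M) = (\<integral>\<^sup>+\<omega>. liminf (\<lambda>n. ennreal ((f n \<omega>)\<^sup>2)) \<partial>M)"
  proof (rule nn_integral_cong_AE, use lim in eventually_elim)
    case (elim \<omega>)
    then have "(\<lambda>n. ennreal ((f n \<omega>)\<^sup>2)) \<longlonglongrightarrow> ennreal ((g \<omega>)\<^sup>2)"
      by (intro tendsto_intros)
    then show ?case
      by (rule lim_imp_Liminf[symmetric, rotated]) simp
  qed
  also have "\<dots> \<le> liminf (\<lambda>n. \<integral>\<^sup>+\<omega>. ennreal ((f n \<omega>)\<^sup>2) \<partial>M)"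
    by (rule nn_integral_liminf) measurable
  also have "\<dots> \<le> B"
    using le Liminf_le[of sequentially "\<lambda>n. \<integral>\<^sup>+\<omega>. ennreal ((f n \<omega>)\<^sup>2) \<partial>M" B] by simp
  finally show ?thesis .
qed

text \<open>Approximating \<open>F s - F 0\<close> by Riemann sums of \<open>G\<close> and using convexity of the square together
  with Fatou avoids the joint measurability of \<open>G\<close> that Tonelli's theorem would need.\<close>
lemma nn_integral_increment_square_le:
  fixes F G :: "real \<Rightarrow> 'a \<Rightarrow> real"
  assumes s: "0 < s"
    and G [measurable]: "\<And>t. t \<in> {0..s} \<Longrightarrow> G t \<in> borel_measurable M"
    and FG: "AE \<omega> in M. (\<forall>t\<in>{0..s}. ((\<lambda>t. F t \<omega>) has_real_derivative G t \<omega>) (at t)) \<and>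
      continuous_on {0..s} (\<lambda>t. G t \<omega>)"
    and le: "\<And>t. t \<in> {0..s} \<Longrightarrow> (\<integral>\<^sup>+\<omega>. ennreal ((G t \<omega>)\<^sup>2) \<partial>M) \<le> B"
  shows "(\<integral>\<^sup>+\<omega>. ennreal (((F s \<omega> - F 0 \<omega>) / s)\<^sup>2) \<partial>M) \<le> B"
proof (rule nn_integral_square_tendsto_le)
  \<comment> \<open>The Riemann sum divided by \<open>s\<close>, that is, the plain mean of
    \<open>G\<close> over the \<open>Suc n\<close> left endpoints.\<close>
  define R where "R n \<omega> = (\<Sum>i\<le>n. G (real i * s / real (Suc n)) \<omega>) / Suc n" for n \<omega>
  have t: "real i * s / real (Suc n) \<in> {0..s}" if "i \<le> n" for i n :: nat
    using s mult_right_mono[of "real i" "real (Suc n)" s] that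
    by (simp add: divide_le_eq mult.commute)
  show "(\<lambda>\<omega>. R n \<omega>) \<in> borel_measurable M" for n
    unfolding R_def using t by (intro borel_measurable_divide borel_measurable_sum G) auto
  show "AE \<omega> in M. (\<lambda>n. R n \<omega>) \<longlonglongrightarrow> (F s \<omega> - F 0 \<omega>) / s"
    using FG
  proof eventually_elim
    case (elim \<omega>)
    then have "(\<lambda>n. s / Suc n * (\<Sum>i\<le>n. G (real i * s / real (Suc n)) \<omega>)) \<longlonglongrightarrow> F s \<omega> - F 0 \<omega>"
      using s by (intro riemann_sums_converge) auto
    then have "(\<lambda>n. s / Suc n * (\<Sum>i\<le>n. G (real i * s / real (Suc n)) \<omega>) / s) \<longlonglongrightarrow> (F s \<omega> - F 0 \<omega>) / s"
      by (rule tendsto_divide) (use s in auto)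
    then show ?case
      using s by (simp add: R_def)
  qed
  have "(\<integral>\<^sup>+\<omega>. ennreal ((R n \<omega>)\<^sup>2) \<partial>M) \<le> B" for n
  proof -
    \<comment> \<open>Cauchy-Schwarz against the constant 1: the square of a mean is at most the
      mean of the squares.\<close>
    have R2: "(R n \<omega>)\<^sup>2 \<le> (\<Sum>i\<le>n. (G (real i * s / real (Suc n)) \<omega>)\<^sup>2) / Suc n" for \<omega>
    proof -
      have "(\<Sum>i\<le>n. G (real i * s / real (Suc n)) \<omega>)\<^sup>2 \<le> (\<Sum>i\<le>n. (G (real i * s / real (Suc n)) \<omega>)\<^sup>2) * (\<Sum>i\<le>n. 1\<^sup>2)"
        using Cauchy_Schwarz_ineq_sum[of "\<lambda>i. G (real i * s / real (Suc n)) \<omega>" "\<lambda>_. 1" "{..n}"] by simp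
      then show ?thesis
        by (simp add: R_def power_divide divide_simps power2_eq_square)
    qed
    have "(\<integral>\<^sup>+\<omega>. ennreal ((R n \<omega>)\<^sup>2) \<partial>M)
        \<le> (\<integral>\<^sup>+\<omega>. (\<Sum>i\<le>n. ennreal ((G (real i * s / real (Suc n)) \<omega>)\<^sup>2)) * ennreal (1 / Suc n) \<partial>M)"
      using R2 by (intro nn_integral_mono)
        (simp add: sum_nonneg ennreal_mult[symmetric] ennreal_leI)
    also have "\<dots> = (\<Sum>i\<le>n. \<integral>\<^sup>+\<omega>. ennreal ((G (real i * s / real (Suc n)) \<omega>)\<^sup>2) \<partial>M) * ennreal (1 / Suc n)"
    proof -
      have m: "(\<lambda>\<omega>. ennreal ((G (real i * s / real (Suc n)) \<omega>)\<^sup>2)) \<in> borel_measurable M" if "i \<le> n" for i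
        using G[OF t[OF that]] by measurable
      show ?thesis
        by (subst nn_integral_multc, use m in \<open>intro borel_measurable_sum, simp\<close>)
          (subst nn_integral_sum, use m in auto)
    qed
    also have "\<dots> \<le> (\<Sum>i\<le>n. B) * ennreal (1 / Suc n)"
      using le t by (intro mult_right_mono sum_mono) auto
    also have "\<dots> = B * (ennreal (Suc n) * ennreal (1 / Suc n))"
      by (simp add: ennreal_of_nat_eq_real_of_nat mult_ac)
    also have "\<dots> = B"
      by (subst ennreal_mult[symmetric]) auto
    finally show ?thesis .
  qed
  then show "\<forall>\<^sub>F n in sequentially. (\<integral>\<^sup>+\<omega>. ennreal ((R n \<omega>)\<^sup>2) \<partial>M) \<le> B" by simp
qed

text \<open>The integrated form of
  \<open>(sqrt f - sqrt g)\<^sup>2 + 2 * sqrt (f * g) = f + g\<close>. It reduces a comparison of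
  Hellinger distances at equal masses to one of affinities, and keeping the affinity on the left
  avoids subtraction in \<open>ennreal\<close>.\<close>

lemma nn_integral_hellinger:
  fixes f g :: "'a \<Rightarrow> real"
  assumes [measurable]: "f \<in> borel_measurable M" "g \<in> borel_measurable M"
    and pos: "AE \<omega> in M. 0 < f \<omega>" "AE \<omega> in M. 0 < g \<omega>"
  shows "(\<integral>\<^sup>+\<omega>. ennreal ((sqrt (f \<omega>) - sqrt (g \<omega>))\<^sup>2) \<partial>M) + 2 * (\<integral>\<^sup>+\<omega>. ennreal (sqrt (f \<omega> * g \<omega>)) \<partial>M)
    = (\<integral>\<^sup>+\<omega>. ennreal (f \<omega>) \<partial>M) + (\<integral>\<^sup>+\<omega>. ennreal (g \<omega>) \<partial>M)"
proof -
  have "(\<integral>\<^sup>+\<omega>. ennreal ((sqrt (f \<omega>) - sqrt (g \<omega>))\<^sup>2) + 2 * ennreal (sqrt (f \<omega> * g \<omega>)) \<partial>M)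
      = (\<integral>\<^sup>+\<omega>. ennreal (f \<omega>) + ennreal (g \<omega>) \<partial>M)"
  proof (rule nn_integral_cong_AE, use pos in eventually_elim)
    case (elim \<omega>)
    have "ennreal ((sqrt (f \<omega>) - sqrt (g \<omega>))\<^sup>2) + 2 * ennreal (sqrt (f \<omega> * g \<omega>))
        = ennreal ((sqrt (f \<omega>) - sqrt (g \<omega>))\<^sup>2 + 2 * sqrt (f \<omega> * g \<omega>))"
      using elim by (simp add: ennreal_plus ennreal_mult)
    also have "(sqrt (f \<omega>) - sqrt (g \<omega>))\<^sup>2 + 2 * sqrt (f \<omega> * g \<omega>) = f \<omega> + g \<omega>"
      using elim by (simp add: power2_diff real_sqrt_mult)
    finally show ?case using elim by (simp add: ennreal_plus)
  qed
  then show ?thesis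
    by (simp add: nn_integral_add nn_integral_cmult)
qed

text \<open>\<open>g\<close> acts as the conditional expectation of \<open>f\<close> given
  \<open>\<kappa>\<close>: functions that factor through \<open>\<kappa>\<close> have the same
  integral against either density.\<close>

lemma nn_integral_distr_density:
  assumes [measurable]: "\<kappa> \<in> M \<rightarrow>\<^sub>M N" "f \<in> borel_measurable M" "g \<in> borel_measurable N" "h \<in> borel_measurable N"
    and eq: "distr (density M f) N \<kappa> = density (distr M N \<kappa>) g"
  shows "(\<integral>\<^sup>+\<omega>. f \<omega> * h (\<kappa> \<omega>) \<partial>M) = (\<integral>\<^sup>+\<eta>. g \<eta> * h \<eta> \<partial>distr M N \<kappa>)"
proof -
  have "(\<integral>\<^sup>+\<omega>. f \<omega> * h (\<kappa> \<omega>) \<partial>M) = (\<integral>\<^sup>+\<eta>. h \<eta> \<partial>distr (density M f) N \<kappa>)"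
    by (simp add: nn_integral_distr nn_integral_density)
  also have "\<dots> = (\<integral>\<^sup>+\<eta>. g \<eta> * h \<eta> \<partial>distr M N \<kappa>)"
    unfolding eq by (simp add: nn_integral_density)
  finally show ?thesis .
qed

text \<open>With \<open>a = sqrt (g1 / g0) \<circ> \<kappa>\<close>, AM-GM gives \<open>2 sqrt (f0 * f1) \<le> f0 * a + f1 / a\<close>, and both terms on
  the right integrate to the Hellinger affinity of \<open>g0\<close> and \<open>g1\<close>.\<close>
lemma hellinger_monotone:
  fixes f0 f1 :: "'a \<Rightarrow> real" and g0 g1 :: "'b \<Rightarrow> real"
  assumes m [measurable]: "\<kappa> \<in> M \<rightarrow>\<^sub>M N" "f0 \<in> borel_measurable M" "f1 \<in> borel_measurable M"
      "g0 \<in> borel_measurable N" "g1 \<in> borel_measurable N"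
    and f: "AE \<omega> in M. 0 < f0 \<omega>" "AE \<omega> in M. 0 < f1 \<omega>"
    and g: "AE \<eta> in distr M N \<kappa>. 0 < g0 \<eta>" "AE \<eta> in distr M N \<kappa>. 0 < g1 \<eta>"
    and fin: "(\<integral>\<^sup>+\<omega>. ennreal (f0 \<omega>) \<partial>M) < \<infinity>" "(\<integral>\<^sup>+\<omega>. ennreal (f1 \<omega>) \<partial>M) < \<infinity>"
    and eq0: "distr (density M f0) N \<kappa> = density (distr M N \<kappa>) g0"
    and eq1: "distr (density M f1) N \<kappa> = density (distr M N \<kappa>) g1"
  shows "(\<integral>\<^sup>+\<eta>. ennreal ((sqrt (g1 \<eta>) - sqrt (g0 \<eta>))\<^sup>2) \<partial>distr M N \<kappa>)
    \<le> (\<integral>\<^sup>+\<omega>. ennreal ((sqrt (f1 \<omega>) - sqrt (f0 \<omega>))\<^sup>2) \<partial>M)"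
proof -
  let ?N = "distr M N \<kappa>"
  define a where "a \<eta> = sqrt (g1 \<eta> / g0 \<eta>)" for \<eta>
  have [measurable]: "a \<in> borel_measurable N" unfolding a_def by measurable
  let ?F = "\<integral>\<^sup>+\<omega>. ennreal (sqrt (f1 \<omega> * f0 \<omega>)) \<partial>M"
  let ?G = "\<integral>\<^sup>+\<eta>. ennreal (sqrt (g1 \<eta> * g0 \<eta>)) \<partial>?N"
  have gk: "AE \<omega> in M. 0 < g0 (\<kappa> \<omega>)" "AE \<omega> in M. 0 < g1 (\<kappa> \<omega>)"
    using g by (auto simp: AE_distr_iff)
  have "2 * ?F = (\<integral>\<^sup>+\<omega>. ennreal (2 * sqrt (f1 \<omega> * f0 \<omega>)) \<partial>M)"
    by (simp add: nn_integral_cmult[symmetric] ennreal_mult')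
  also have "\<dots> \<le> (\<integral>\<^sup>+\<omega>. ennreal (f0 \<omega>) * ennreal (a (\<kappa> \<omega>)) + ennreal (f1 \<omega>) * ennreal (1 / a (\<kappa> \<omega>)) \<partial>M)"
  proof (rule nn_integral_mono_AE, use f gk in eventually_elim)
    case (elim \<omega>)
    have a: "a (\<kappa> \<omega>) > 0" using elim by (simp add: a_def)
    have "2 * sqrt (f1 \<omega> * f0 \<omega>) = 2 * sqrt ((f0 \<omega> * a (\<kappa> \<omega>)) * (f1 \<omega> * (1 / a (\<kappa> \<omega>))))"
      using a by (simp add: mult.commute)
    also have "\<dots> \<le> f0 \<omega> * a (\<kappa> \<omega>) + f1 \<omega> * (1 / a (\<kappa> \<omega>))"
      using arith_geo_mean_sqrt[of "f0 \<omega> * a (\<kappa> \<omega>)" "f1 \<omega> * (1 / a (\<kappa> \<omega>))"] a elim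
      by (simp add: field_simps)
    finally show ?case
      using a elim by (simp add: ennreal_mult[symmetric] ennreal_plus[symmetric] ennreal_leI del: ennreal_plus)
  qed
  also have "\<dots> = (\<integral>\<^sup>+\<eta>. ennreal (g0 \<eta>) * ennreal (a \<eta>) \<partial>?N) + (\<integral>\<^sup>+\<eta>. ennreal (g1 \<eta>) * ennreal (1 / a \<eta>) \<partial>?N)"
    by (subst nn_integral_add) (simp_all add: nn_integral_distr_density[OF _ _ _ _ eq0, of "\<lambda>\<eta>. ennreal (a \<eta>)"]
      nn_integral_distr_density[OF _ _ _ _ eq1, of "\<lambda>\<eta>. ennreal (1 / a \<eta>)"])
  also have "(\<integral>\<^sup>+\<eta>. ennreal (g0 \<eta>) * ennreal (a \<eta>) \<partial>?N) = ?G"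
  proof (rule nn_integral_cong_AE, use g in eventually_elim)
    case (elim \<eta>)
    then have "g0 \<eta> * a \<eta> = sqrt (g1 \<eta> * g0 \<eta>)"
      using real_div_sqrt[of "g0 \<eta>"] by (simp add: a_def real_sqrt_divide real_sqrt_mult field_simps)
    with elim show ?case by (simp add: ennreal_mult[symmetric] a_def)
  qed
  also have "(\<integral>\<^sup>+\<eta>. ennreal (g1 \<eta>) * ennreal (1 / a \<eta>) \<partial>?N) = ?G"
  proof (rule nn_integral_cong_AE, use g in eventually_elim)
    case (elim \<eta>)
    then have "g1 \<eta> * (1 / a \<eta>) = sqrt (g1 \<eta> * g0 \<eta>)"
      using real_div_sqrt[of "g1 \<eta>"] by (simp add: a_def real_sqrt_divide real_sqrt_mult field_simps)
    with elim show ?case by (simp add: ennreal_mult[symmetric] a_def)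
  qed
  finally have FG: "2 * ?F \<le> 2 * ?G" by (simp add: mult_2)
  \<comment> \<open>Testing with the constant 1 shows that the push-forward preserves total masses,
    so both Hellinger identities have the same right-hand side.\<close>
  have mass: "(\<integral>\<^sup>+\<eta>. ennreal (g0 \<eta>) \<partial>?N) = (\<integral>\<^sup>+\<omega>. ennreal (f0 \<omega>) \<partial>M)"
    "(\<integral>\<^sup>+\<eta>. ennreal (g1 \<eta>) \<partial>?N) = (\<integral>\<^sup>+\<omega>. ennreal (f1 \<omega>) \<partial>M)"
    using nn_integral_distr_density[OF _ _ _ _ eq0, of "\<lambda>_. 1"]
      nn_integral_distr_density[OF _ _ _ _ eq1, of "\<lambda>_. 1"] by simp_all
  have hf: "(\<integral>\<^sup>+\<omega>. ennreal ((sqrt (f1 \<omega>) - sqrt (f0 \<omega>))\<^sup>2) \<partial>M) + 2 * ?F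
      = (\<integral>\<^sup>+\<omega>. ennreal (f1 \<omega>) \<partial>M) + (\<integral>\<^sup>+\<omega>. ennreal (f0 \<omega>) \<partial>M)"
    using f by (intro nn_integral_hellinger) auto
  have hg: "(\<integral>\<^sup>+\<eta>. ennreal ((sqrt (g1 \<eta>) - sqrt (g0 \<eta>))\<^sup>2) \<partial>?N) + 2 * ?G
      = (\<integral>\<^sup>+\<omega>. ennreal (f1 \<omega>) \<partial>M) + (\<integral>\<^sup>+\<omega>. ennreal (f0 \<omega>) \<partial>M)"
    using g by (subst nn_integral_hellinger) (auto simp: mass)
  \<comment> \<open>The affinity is bounded by the total masses and hence finite, which permits
    cancelling \<open>2 * ?G\<close> in \<open>ennreal\<close> below.\<close>
  have "2 * ?G \<le> (\<integral>\<^sup>+\<omega>. ennreal (f1 \<omega>) \<partial>M) + (\<integral>\<^sup>+\<omega>. ennreal (f0 \<omega>) \<partial>M)"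
    unfolding hg[symmetric] by (rule add_increasing) simp_all
  also have "\<dots> < top" using fin by simp
  finally have "2 * ?G < top" .
  moreover have "2 * ?G + (\<integral>\<^sup>+\<eta>. ennreal ((sqrt (g1 \<eta>) - sqrt (g0 \<eta>))\<^sup>2) \<partial>?N)
      \<le> 2 * ?G + (\<integral>\<^sup>+\<omega>. ennreal ((sqrt (f1 \<omega>) - sqrt (f0 \<omega>))\<^sup>2) \<partial>M)"
    using add_left_mono[OF FG] by (subst (1 2) add.commute) (simp only: hg hf[symmetric])
  ultimately show ?thesis
    by (auto simp: ennreal_add_left_cancel_le)
qed

section \<open>Monotonicity of the Fisher form\<close>

lemma in_L2_norm:
  assumes "in_Lk 2 \<nu> f"
  shows "(\<integral>\<omega>. f \<omega> * f \<omega> \<partial>completion \<nu>) = (norm_Lk 2 \<nu> f)\<^sup>2"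
    and "(\<integral>\<^sup>+\<omega>. ennreal ((f \<omega>)\<^sup>2) \<partial>completion \<nu>) = ennreal ((norm_Lk 2 \<nu> f)\<^sup>2)"
proof -
  have int: "integrable (completion \<nu>) (\<lambda>\<omega>. (f \<omega>)\<^sup>2)"
    using assms by (simp add: in_Lk_def)
  have norm: "(norm_Lk 2 \<nu> f)\<^sup>2 = (\<integral>\<omega>. (f \<omega>)\<^sup>2 \<partial>completion \<nu>)"
    by (simp add: norm_Lk_def powr_half_sqrt)
  then show "(\<integral>\<omega>. f \<omega> * f \<omega> \<partial>completion \<nu>) = (norm_Lk 2 \<nu> f)\<^sup>2"
    by (simp add: power2_eq_square)
  show "(\<integral>\<^sup>+\<omega>. ennreal ((f \<omega>)\<^sup>2) \<partial>completion \<nu>) = ennreal ((norm_Lk 2 \<nu> f)\<^sup>2)"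
    using int by (simp add: norm nn_integral_eq_integral)
qed

text \<open>The factor \<open>sqrt q\<close> transports an element of L2 over \<open>p\<close>
  isometrically to L2 over \<open>\<mu>\<close>. Logarithmic derivatives at different points of a
  model thus become functions over one fixed measure, where increments and limits can be
  taken.\<close>

lemma in_L2_density:
  fixes f q :: "'a \<Rightarrow> real"
  assumes q: "q \<in> borel_measurable \<mu>" "AE \<omega> in \<mu>. 0 < q \<omega>"
    and p: "p = density \<mu> (\<lambda>\<omega>. ennreal (q \<omega>))"
    and f: "in_Lk 2 p f"
  shows "(\<lambda>\<omega>. f \<omega> * sqrt (q \<omega>)) \<in> borel_measurable (completion \<mu>)"
    and "(\<integral>\<^sup>+\<omega>. ennreal ((f \<omega> * sqrt (q \<omega>))\<^sup>2) \<partial>completion \<mu>) = ennreal ((norm_Lk 2 p f)\<^sup>2)"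
proof -
  note [measurable] = q(1)
  obtain g where g: "g \<in> borel_measurable p" "AE \<omega> in p. f \<omega> = g \<omega>"
    using f completion_ex_borel_measurable_real[of f p] by (auto simp: in_Lk_def)
  have [measurable]: "g \<in> borel_measurable \<mu>" using g(1) by (simp add: p)
  \<comment> \<open>Since \<open>q\<close> is positive almost everywhere, an equality
    \<open>p\<close>-almost everywhere also holds \<open>\<mu>\<close>-almost everywhere.\<close>
  have "AE \<omega> in \<mu>. 0 < q \<omega> \<longrightarrow> f \<omega> = g \<omega>"
    using g(2) unfolding p by (subst (asm) AE_density) auto
  with q(2) have ae: "AE \<omega> in \<mu>. g \<omega> = f \<omega>"
    by eventually_elim simp
  then have eq: "AE \<omega> in \<mu>. g \<omega> * sqrt (q \<omega>) = f \<omega> * sqrt (q \<omega>)"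
    by eventually_elim simp
  have "(\<lambda>\<omega>. g \<omega> * sqrt (q \<omega>)) \<in> borel_measurable (completion \<mu>)"
    by (intro measurable_completion) measurable
  then show "(\<lambda>\<omega>. f \<omega> * sqrt (q \<omega>)) \<in> borel_measurable (completion \<mu>)"
    using eq by (rule borel_measurable_completion_AE)
  have "(\<integral>\<^sup>+\<omega>. ennreal ((f \<omega> * sqrt (q \<omega>))\<^sup>2) \<partial>completion \<mu>)
      = (\<integral>\<^sup>+\<omega>. ennreal (q \<omega>) * ennreal ((g \<omega>)\<^sup>2) \<partial>\<mu>)"
    unfolding nn_integral_completion
    by (rule nn_integral_cong_AE, use ae q(2) in eventually_elim)
      (simp add: power_mult_distrib ennreal_mult mult.commute)
  also have "\<dots> = (\<integral>\<^sup>+\<omega>. ennreal ((g \<omega>)\<^sup>2) \<partial>p)"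
    by (simp add: p nn_integral_density)
  also have "\<dots> = (\<integral>\<^sup>+\<omega>. ennreal ((f \<omega>)\<^sup>2) \<partial>completion p)"
    unfolding nn_integral_completion
    by (rule nn_integral_cong_AE, use g(2) in eventually_elim) simp
  finally show "(\<integral>\<^sup>+\<omega>. ennreal ((f \<omega> * sqrt (q \<omega>))\<^sup>2) \<partial>completion \<mu>) = ennreal ((norm_Lk 2 p f)\<^sup>2)"
    using in_L2_norm(2)[OF f] by simp
qed

text \<open>A continuous map takes its values in the underlying set of the target topology, so
  \<open>p x\<close> lies in \<open>M_plus \<mu>\<close> and has an integrable density; the total
  mass is the same for every density of \<open>p x\<close>.\<close>

lemma integrable_model_finite:
  assumes model: "integrable_model k A \<mu> p" and q: "density_potential k A \<mu> p q"
  shows "(\<integral>\<^sup>+\<omega>. ennreal (q x \<omega>) \<partial>\<mu>) < \<infinity>"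
proof -
  have fin: "finite_measure \<mu>" using model by (simp add: integrable_model_def)
  interpret Metric_space "M_plus \<mu>" "L1_dist \<mu>"
    by (rule Metric_space_M_plus[OF fin])
  have "p x \<in> M_plus \<mu>"
    using model continuous_map_image_subset_topspace[of euclidean "L1_topology \<mu>" p]
    by (auto simp: integrable_model_def L1_topology_def)
  then obtain \<phi> where \<phi>: "integrable \<mu> \<phi>" "p x = density \<mu> (\<lambda>\<omega>. ennreal (\<phi> \<omega>))"
    by (auto simp: M_plus_def)
  have "(\<integral>\<^sup>+\<omega>. ennreal (q x \<omega>) \<partial>\<mu>) = emeasure (p x) (space \<mu>)"
    using density_potentialD(1,2)[OF q, of x] by (simp add: emeasure_density cong: nn_integral_cong)
  also have "\<dots> = (\<integral>\<^sup>+\<omega>. ennreal (\<phi> \<omega>) \<partial>\<mu>)"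
    using \<phi> by (simp add: emeasure_density cong: nn_integral_cong)
  also have "\<dots> \<le> (\<integral>\<^sup>+\<omega>. ennreal (norm (\<phi> \<omega>)) \<partial>\<mu>)"
    by (intro nn_integral_mono ennreal_leI) simp
  also have "\<dots> < \<infinity>"
    using \<phi>(1) by (simp add: integrable_iff_bounded)
  finally show ?thesis .
qed

text \<open>Writing \<open>sqrt q = exp (ln q / 2)\<close> turns the Gateaux derivative of
  \<open>ln q\<close> into that of \<open>sqrt q\<close>. The factor 2 normalizes the derivative so
  that its squared L2 norm is exactly the Fisher form in the direction of the line.\<close>

lemma sqrt_density_along_line:
  assumes A: "banach_manifold A" "c \<in> A" and q: "density_potential k A \<mu> p q"
    and I: "\<And>t. t \<in> I \<Longrightarrow> u + t *\<^sub>R w \<in> snd c ` fst c"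
    and y: "\<And>t. y t = chart_inv c (u + t *\<^sub>R w)"
    and G: "\<And>t \<omega>. G t \<omega> = log_derivative A q (y t) (tangent_vector A c (y t) w) \<omega> * sqrt (q (y t) \<omega>)"
  shows "AE \<omega> in \<mu>. (\<forall>t\<in>I. ((\<lambda>s. 2 * sqrt (q (y s) \<omega>)) has_real_derivative G t \<omega>) (at t)) \<and>
    continuous_on I (\<lambda>t. G t \<omega>)"
proof -
  have "AE \<omega> in \<mu>. (\<forall>x. 0 < q x \<omega>) \<and> continuously_gateaux_differentiable A (\<lambda>x. ln (q x \<omega>))"
    using q unfolding density_potential_def by blast
  then show ?thesis
  proof eventually_elim
    case (elim \<omega>)
    let ?f = "\<lambda>x. ln (q x \<omega>)"
    let ?d = "\<lambda>t. gateaux_derivative A ?f (y t) (tangent_vector A c (y t) w)"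
    have sq: "sqrt (q x \<omega>) = exp (?f x / 2)" for x
    proof -
      have "sqrt (q x \<omega>) = sqrt ((exp (?f x / 2))\<^sup>2)"
        using elim by (simp add: power2_eq_square flip: exp_add)
      then show ?thesis by simp
    qed
    have d: "((\<lambda>s. ?f (y s)) has_real_derivative ?d t) (at t)" if "t \<in> I" for t
      using gateaux_derivative_along_line(1)[OF A conjunct2[OF elim] I y that] by simp
    have cont: "continuous_on I ?d"
      using gateaux_derivative_along_line(2)[OF A conjunct2[OF elim] I y] by simp
    have G': "G t \<omega> = ?d t * exp (?f (y t) / 2)" for t
      by (simp add: G sq log_derivative_def)
    have "continuous_on I (\<lambda>t. ?f (y t))"
      using d by (meson DERIV_isCont continuous_at_imp_continuous_on)
    then have "continuous_on I (\<lambda>t. G t \<omega>)"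
      unfolding G' using cont
      by (intro continuous_on_mult continuous_on_exp continuous_on_divide continuous_on_const) auto
    moreover have "((\<lambda>s. 2 * sqrt (q (y s) \<omega>)) has_real_derivative G t \<omega>) (at t)" if "t \<in> I" for t
      unfolding sq G' by (rule derivative_eq_intros d[OF that] refl | simp)+
    ultimately show ?case by blast
  qed
qed

theorem theorem1p2:
  fixes A :: "('m::t3_space, 'e::banach) chart set"
    and \<mu>1 :: "'a::topological_space measure"
    and p1 :: "'m \<Rightarrow> 'a measure"
    and \<kappa> :: "'a \<Rightarrow> 'b::topological_space"
  assumes "sets \<mu>1 = sets borel"
    and "\<kappa> \<in> borel \<rightarrow>\<^sub>M borel"
    and "integrable_model 2 A \<mu>1 p1"
    and "integrable_model 2 A (distr \<mu>1 borel \<kappa>) (\<lambda>x. distr (p1 x) borel \<kappa>)"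
  shows "\<forall>x. \<forall>V\<in>tangent_space A x.
           fisher_form A \<mu>1 p1 x V V
             \<ge> fisher_form A (distr \<mu>1 borel \<kappa>) (\<lambda>x. distr (p1 x) borel \<kappa>) x V V"
proof (intro allI ballI)
  fix x V assume V: "V \<in> tangent_space A x"
  define \<mu>2 where "\<mu>2 = distr \<mu>1 borel \<kappa>"
  define p2 where "p2 z = distr (p1 z) borel \<kappa>" for z
  note m1 = assms(3) and m2 = assms(4)[folded \<mu>2_def p2_def]
  have A: "banach_manifold A" using m1 by (simp add: integrable_model_def)
  have fin: "finite_measure \<mu>1" "finite_measure \<mu>2"
    using m1 m2 by (auto simp: integrable_model_def)
  obtain q1 where q1: "density_potential 2 A \<mu>1 p1 q1"
    using m1 by (auto simp: integrable_model_def)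
  obtain q2 where q2: "density_potential 2 A \<mu>2 p2 q2"
    using m2 by (auto simp: integrable_model_def)
  have \<kappa> [measurable]: "\<kappa> \<in> \<mu>1 \<rightarrow>\<^sub>M borel"
    using assms(1,2) measurable_cong_sets by blast
  have "x \<in> (\<Union>c\<in>A. fst c)"
    using A unfolding banach_manifold_def by blast
  then obtain c where c: "c \<in> A" "x \<in> fst c" by blast
  then have cx: "c \<in> charts_at A x" by (simp add: charts_at_def)
  define w where "w = V c"
  \<comment> \<open>Condition (2) of a model concerns vector fields only, so \<open>V\<close> is
    extended; near \<open>x\<close> the extension keeps the constant coordinates
    \<open>w\<close>.\<close>
  obtain X W where X: "continuous_vector_field A X" and W: "open W" "x \<in> W" "W \<subseteq> fst c"
    and XW: "\<And>z. z \<in> W \<Longrightarrow> X z = tangent_vector A c z w"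
    using tangent_vector_extension[OF A c] by blast
  have Xx: "X x = V"
    using V cx XW[OF W(2)] by (simp add: tangent_space_def w_def)
  define y where "y t = chart_inv c (snd c x + t *\<^sub>R w)" for t
  have y0: "y 0 = x" using chart_inv_chart[OF A c] by (simp add: y_def)
  \<comment> \<open>For parameters in \<open>I\<close> the line stays in \<open>W\<close>, where
    \<open>X\<close> is the velocity of \<open>y\<close>.\<close>
  define I where "I = (\<lambda>t. snd c x + t *\<^sub>R w) -` (snd c ` W)"
  have I: "snd c x + t *\<^sub>R w \<in> snd c ` fst c" if "t \<in> I" for t
    using that W(3) by (auto simp: I_def)
  have "open I"
    unfolding I_def using open_chart_image[OF A c(1) W(1,3)]
    by (rule open_vimage) (intro continuous_intros)
  moreover have "0 \<in> I" using W(2) by (simp add: I_def)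
  ultimately obtain \<delta> where \<delta>: "\<delta> > 0" "cball 0 \<delta> \<subseteq> I"
    by (meson open_contains_cball)
  have "y t \<in> W" if "t \<in> I" for t
    using that chart_inv_chart[OF A c(1)] W(3) by (force simp: I_def y_def)
  then have Xy: "X (y t) = tangent_vector A c (y t) w" if "t \<in> I" for t
    using XW that by blast
  define D1 where "D1 t \<omega> =
      log_derivative A q1 (y t) (tangent_vector A c (y t) w) \<omega> * sqrt (q1 (y t) \<omega>)" for t \<omega>
  define D2 where "D2 t \<omega> =
      log_derivative A q2 (y t) (tangent_vector A c (y t) w) \<omega> * sqrt (q2 (y t) \<omega>)" for t \<omega>
  define N1 where "N1 z = norm_Lk 2 (p1 z) (log_derivative A q1 z (X z))" for z
  define N2 where "N2 z = norm_Lk 2 (p2 z) (log_derivative A q2 z (X z))" for z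
  have L: "in_Lk 2 (p1 z) (log_derivative A q1 z (X z))" "in_Lk 2 (p2 z) (log_derivative A q2 z (X z))" for z
    using q1 q2 X unfolding density_potential_def by blast+
  have F1: "fisher_form A \<mu>1 p1 x V V = (N1 x)\<^sup>2"
    using fisher_form_eq[OF A fin(1) q1 V V] in_L2_norm(1)[OF L(1), of x] by (simp add: N1_def Xx)
  have F2: "fisher_form A \<mu>2 p2 x V V = (N2 x)\<^sup>2"
    using fisher_form_eq[OF A fin(2) q2 V V] in_L2_norm(1)[OF L(2), of x] by (simp add: N2_def Xx)
  note q1D = density_potentialD[OF q1] and q2D = density_potentialD[OF q2]
  note [measurable] = q1D(1) q2D(1)
  have q2m: "q2 z \<in> borel_measurable borel" for z
    using q2D(1)[of z] by (simp add: \<mu>2_def)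
  have D1m: "D1 t \<in> borel_measurable (completion \<mu>1)"
    and D1i: "(\<integral>\<^sup>+\<omega>. ennreal ((D1 t \<omega>)\<^sup>2) \<partial>completion \<mu>1) = ennreal ((N1 (y t))\<^sup>2)" if "t \<in> I" for t
    using in_L2_density[OF q1D(1,3,2) L(1)[of "y t"]]
    unfolding D1_def[abs_def] N1_def Xy[OF that, symmetric] by blast+
  have D2i: "(\<integral>\<^sup>+\<omega>. ennreal ((D2 0 \<omega>)\<^sup>2) \<partial>completion \<mu>2) = ennreal ((N2 x)\<^sup>2)"
    using in_L2_density(2)[OF q2D(1,3,2) L(2)[of "y 0"]]
    unfolding D2_def N2_def Xy[OF \<open>0 \<in> I\<close>, symmetric] unfolding y0 .
  have S1: "AE \<omega> in completion \<mu>1. (\<forall>t\<in>I. ((\<lambda>s. 2 * sqrt (q1 (y s) \<omega>)) has_real_derivative D1 t \<omega>) (at t)) \<and>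
      continuous_on I (\<lambda>t. D1 t \<omega>)"
    using I y_def D1_def by (intro AE_completion sqrt_density_along_line[OF A c(1) q1]) blast+
  have S2: "AE \<omega> in completion \<mu>2. (\<forall>t\<in>I. ((\<lambda>s. 2 * sqrt (q2 (y s) \<omega>)) has_real_derivative D2 t \<omega>) (at t)) \<and>
      continuous_on I (\<lambda>t. D2 t \<omega>)"
    using I y_def D2_def by (intro AE_completion sqrt_density_along_line[OF A c(1) q2]) blast+
  define H1 where "H1 s \<omega> = (2 * sqrt (q1 (y s) \<omega>) - 2 * sqrt (q1 (y 0) \<omega>)) / s" for s \<omega>
  define H2 where "H2 s \<omega> = (2 * sqrt (q2 (y s) \<omega>) - 2 * sqrt (q2 (y 0) \<omega>)) / s" for s \<omega>
  \<comment> \<open>Both sides are Hellinger distances scaled by \<open>4 / s\<^sup>2\<close>. The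
    case \<open>s = 0\<close> is included, since division by 0 makes both quotients 0.\<close>
  have mono: "(\<integral>\<^sup>+\<omega>. ennreal ((H2 s \<omega>)\<^sup>2) \<partial>completion \<mu>2) \<le> (\<integral>\<^sup>+\<omega>. ennreal ((H1 s \<omega>)\<^sup>2) \<partial>completion \<mu>1)" for s
  proof -
    have sq: "ennreal (((2 * a - 2 * b) / s)\<^sup>2) = ennreal (4 / s\<^sup>2) * ennreal ((a - b)\<^sup>2)" for a b
    proof -
      have "((2 * a - 2 * b) / s)\<^sup>2 = 4 / s\<^sup>2 * (a - b)\<^sup>2"
        unfolding right_diff_distrib[symmetric] by (simp only: power_divide power_mult_distrib) simp
      then show ?thesis by (simp add: ennreal_mult[symmetric])
    qed
    have H: "ennreal ((H1 s \<omega>)\<^sup>2) = ennreal (4 / s\<^sup>2) * ennreal ((sqrt (q1 (y s) \<omega>) - sqrt (q1 (y 0) \<omega>))\<^sup>2)"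
      "ennreal ((H2 s \<eta>)\<^sup>2) = ennreal (4 / s\<^sup>2) * ennreal ((sqrt (q2 (y s) \<eta>) - sqrt (q2 (y 0) \<eta>))\<^sup>2)" for \<omega> \<eta>
      unfolding H1_def H2_def by (rule sq)+
    have eq: "distr (density \<mu>1 (q1 z)) borel \<kappa> = density \<mu>2 (q2 z)" for z
      using q1D(2)[of z] q2D(2)[of z] by (simp add: p2_def)
    have "(\<integral>\<^sup>+\<eta>. ennreal ((sqrt (q2 (y s) \<eta>) - sqrt (q2 (y 0) \<eta>))\<^sup>2) \<partial>\<mu>2)
        \<le> (\<integral>\<^sup>+\<omega>. ennreal ((sqrt (q1 (y s) \<omega>) - sqrt (q1 (y 0) \<omega>))\<^sup>2) \<partial>\<mu>1)"
      unfolding \<mu>2_def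
      by (rule hellinger_monotone[OF \<kappa> q1D(1) q1D(1) q2m q2m q1D(3) q1D(3)
          q2D(3)[unfolded \<mu>2_def] q2D(3)[unfolded \<mu>2_def]
          integrable_model_finite[OF m1 q1] integrable_model_finite[OF m1 q1]
          eq[unfolded \<mu>2_def] eq[unfolded \<mu>2_def]])
    moreover have "q2 z \<in> borel_measurable \<mu>2" for z by (rule q2D(1))
    ultimately show ?thesis
      unfolding nn_integral_completion H by (simp add: nn_integral_cmult mult_left_mono)
  qed
  \<comment> \<open>Continuity bounds \<open>(N1 (y t))\<^sup>2\<close> by
    \<open>(N1 x)\<^sup>2 + e\<close> only for small \<open>t\<close>; the error \<open>e\<close> is
    removed at the end.\<close>
  have "(N2 x)\<^sup>2 \<le> (N1 x)\<^sup>2 + e" if e: "e > 0" for e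
  proof -
    have "continuous_on UNIV N1"
      using q1 X unfolding density_potential_def N1_def[abs_def] by blast
    moreover have "continuous_on I y"
    proof -
      have "continuous_on (snd c ` fst c) (chart_inv c)"
        using chart_homeomorphism[OF A c(1)] by (simp add: homeomorphism_def)
      then show ?thesis
        unfolding y_def[abs_def]
        by (rule continuous_on_compose2) (use I in \<open>auto intro!: continuous_intros\<close>)
    qed
    ultimately have "continuous_on I (\<lambda>t. N1 (y t))"
      by (rule continuous_on_compose2) simp
    then have "continuous_on I (\<lambda>t. (N1 (y t))\<^sup>2)"
      by (rule continuous_on_power)
    then have "isCont (\<lambda>t. (N1 (y t))\<^sup>2) 0"
      using \<open>open I\<close> \<open>0 \<in> I\<close> continuous_on_eq_continuous_at by blast
    \<comment> \<open>The filter \<open>nhds 0\<close> contains the point 0 itself, so that the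
      bound also covers the left endpoint of \<open>{0..s}\<close>.\<close>
    then have "((\<lambda>t. (N1 (y t))\<^sup>2) \<longlongrightarrow> (N1 x)\<^sup>2) (nhds 0)"
      unfolding isCont_def tendsto_at_iff_tendsto_nhds[of "\<lambda>t. (N1 (y t))\<^sup>2" 0] unfolding y0 .
    then have "\<forall>\<^sub>F t in nhds 0. (N1 (y t))\<^sup>2 < (N1 x)\<^sup>2 + e"
      by (rule order_tendstoD(2)) (use e in simp)
    then obtain d where d: "d > 0" "\<And>t. \<bar>t\<bar> < d \<Longrightarrow> (N1 (y t))\<^sup>2 < (N1 x)\<^sup>2 + e"
      unfolding eventually_nhds_metric dist_real_def by auto
    have up: "(\<integral>\<^sup>+\<omega>. ennreal ((H1 s \<omega>)\<^sup>2) \<partial>completion \<mu>1) \<le> ennreal ((N1 x)\<^sup>2 + e)"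
      if s: "0 < s" "s < d" "s \<le> \<delta>" for s
    proof -
      have sI: "{0..s} \<subseteq> I" using s \<delta>(2) by (auto simp: subset_iff)
      show ?thesis
        unfolding H1_def
      proof (rule nn_integral_increment_square_le[where G = "D1"])
        show "AE \<omega> in completion \<mu>1. (\<forall>t\<in>{0..s}. ((\<lambda>t. 2 * sqrt (q1 (y t) \<omega>)) has_real_derivative D1 t \<omega>) (at t)) \<and>
            continuous_on {0..s} (\<lambda>t. D1 t \<omega>)"
          using S1 by eventually_elim (use sI in \<open>blast intro: continuous_on_subset\<close>)
        show "D1 t \<in> borel_measurable (completion \<mu>1)" if "t \<in> {0..s}" for t
          using D1m that sI by blast
        show "(\<integral>\<^sup>+\<omega>. ennreal ((D1 t \<omega>)\<^sup>2) \<partial>completion \<mu>1) \<le> ennreal ((N1 x)\<^sup>2 + e)"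
          if "t \<in> {0..s}" for t
        proof -
          have "t \<in> I" using that sI by blast
          moreover have "(N1 (y t))\<^sup>2 \<le> (N1 x)\<^sup>2 + e"
            using d(2)[of t] that s by simp
          ultimately show ?thesis by (simp add: D1i ennreal_leI)
        qed
      qed (use s in auto)
    qed
    \<comment> \<open>Fatou works along a sequence, and the bound \<open>up\<close> asks for
      positive parameters; \<open>\<sigma>\<close> tends to 0 through positive values.\<close>
    define \<sigma> where "\<sigma> n = inverse (real (Suc n))" for n
    have \<sigma>: "\<sigma> \<longlonglongrightarrow> 0" "\<And>n. \<sigma> n > 0"
      using LIMSEQ_inverse_real_of_nat by (auto simp: \<sigma>_def[abs_def])
    then have \<sigma>0: "filterlim \<sigma> (at 0) sequentially"
      unfolding filterlim_at by (auto simp: less_imp_neq[symmetric] intro!: always_eventually)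
    \<comment> \<open>The quotients \<open>H2 (\<sigma> n)\<close> tend to the derivative
      \<open>D2 0\<close> almost everywhere and are bounded in L2 by \<open>mono\<close> followed by
      \<open>up\<close>.\<close>
    have "(\<integral>\<^sup>+\<omega>. ennreal ((D2 0 \<omega>)\<^sup>2) \<partial>completion \<mu>2) \<le> ennreal ((N1 x)\<^sup>2 + e)"
    proof (rule nn_integral_square_tendsto_le)
      show "H2 (\<sigma> n) \<in> borel_measurable (completion \<mu>2)" for n
        unfolding H2_def[abs_def] by (intro measurable_completion) measurable
      show "AE \<omega> in completion \<mu>2. (\<lambda>n. H2 (\<sigma> n) \<omega>) \<longlonglongrightarrow> D2 0 \<omega>"
        using S2
      proof eventually_elim
        case (elim \<omega>)
        then have "((\<lambda>s. H2 s \<omega>) \<longlongrightarrow> D2 0 \<omega>) (at 0)"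
          using \<open>0 \<in> I\<close> by (fastforce simp: has_field_derivative_iff H2_def)
        then show ?case by (rule filterlim_compose[OF _ \<sigma>0])
      qed
      have "\<forall>\<^sub>F n in sequentially. \<sigma> n < min d \<delta>"
        using \<sigma>(1) d(1) \<delta>(1) by (intro order_tendstoD(2)) auto
      then show "\<forall>\<^sub>F n in sequentially. (\<integral>\<^sup>+\<omega>. ennreal ((H2 (\<sigma> n) \<omega>)\<^sup>2) \<partial>completion \<mu>2) \<le> ennreal ((N1 x)\<^sup>2 + e)"
      proof eventually_elim
        case (elim n)
        then show ?case
          using order_trans[OF mono up[of "\<sigma> n"]] \<sigma>(2) by simp
      qed
    qed
    then show ?thesis
      using e unfolding D2i by (subst (asm) ennreal_le_iff) auto
  qed
  then have "(N2 x)\<^sup>2 \<le> (N1 x)\<^sup>2"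
    by (rule field_le_epsilon)
  then show "fisher_form A (distr \<mu>1 borel \<kappa>) (\<lambda>x. distr (p1 x) borel \<kappa>) x V V \<le> fisher_form A \<mu>1 p1 x V V"
    using F1 F2 by (simp add: \<mu>2_def p2_def[abs_def])
qed

end
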